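(* Let $n\ge1$, $p\in(0,1)$, $q=\frac{p}{p-1}$, and let $f:\mathbb{R}^n\to[0,\infty)$ be a nonnegative function with $f\not\equiv0$. Consider the convex function $$\psi(z):=\int_{\mathbb{R}^n}\mathcal{L}_p(\tau_z f)(x)\,dx=\int_{\mathbb{R}^n}\mathcal{L}_p(f)(x)\,e^{q\,x\cdot z}\,dx=L(\mathcal{L}_p(f))(qz)\in[0,\infty],\qquad z\in\mathbb{R}^n.$$ Then $\psi$ is always proper, that is, there exists $z_0$ with $\psi(z_0)<\infty$ (equivalently $\inf\psi<\infty$). Moreover, either $$\inf_{z\in\mathbb{R}^n}\psi(z)=0,$$ or else $\psi$ attains its (non-zero) minimum at a unique point, denoted by $s_p(f)$. In the latter case the point $s_p(f)$ is characterized by the property that $$\mathrm{bar}\big(\mathcal{L}_p(\tau_{s_p(f)}f)\big)=0.$$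
   Context: All functions are Borel measurable. For nonnegative $g$ on $\mathbb{R}^n$, $Lg(y)=\int_{\mathbb{R}^n}g(x)e^{x\cdot y}\,dx\in[0,\infty]$; $\tau_z g(x)=g(x-z)$. The $p$-Laplace transform of a nonnegative $f$ is $\mathcal{L}_p(f)(x)=\big(L(f^{1/p})(x)\big)^q=\big(\int_{\mathbb{R}^n}f^{1/p}(y)e^{x\cdot y}\,dy\big)^q$, with $\infty^q=0$ and $0^q=\infty$. $f\not\equiv0$ means that $\{f>0\}$ does not have Lebesgue measure zero. The barycenter of a nonnegative $g$ is $\mathrm{bar}(g)=\frac{\int x\,g(x)\,dx}{\int g(x)\,dx}$; speaking of the barycenter of $g$ implicitly requires $0<\int(1+|x|)g(x)\,dx<\infty$. *)

theory Defs
  imports "HOL-Analysis.Analysis"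
begin

definition laplace :: "('a::euclidean_space \<Rightarrow> ennreal) \<Rightarrow> 'a \<Rightarrow> ennreal" where
  "laplace g y = (\<integral>\<^sup>+ x. g x * ennreal (exp (x \<bullet> y)) \<partial>lborel)"

definition translate :: "'a::ab_group_add \<Rightarrow> ('a \<Rightarrow> 'b) \<Rightarrow> 'a \<Rightarrow> 'b" where
  "translate z g = (\<lambda>x. g (x - z))"

(* u^q on [0,\<infinity>], meant for exponents q < 0 only: \<infinity>^q = 0 and 0^q = \<infinity>. *)
definition ennreal_neg_powr :: "ennreal \<Rightarrow> real \<Rightarrow> ennreal" where
  "ennreal_neg_powr u q =
     (if u = \<infinity> then 0 else if u = 0 then \<infinity> else ennreal (enn2real u powr q))"

(* The exponent p / (p - 1) is negative for 0 < p < 1, the intended range.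
   Since 0 powr (1 / p) = 0, zeros of f are treated correctly. *)
definition laplace_p :: "real \<Rightarrow> ('a::euclidean_space \<Rightarrow> real) \<Rightarrow> 'a \<Rightarrow> ennreal" where
  "laplace_p p f x =
     ennreal_neg_powr (laplace (\<lambda>y. ennreal (f y powr (1 / p))) x) (p / (p - 1))"

definition psi :: "real \<Rightarrow> ('a::euclidean_space \<Rightarrow> real) \<Rightarrow> 'a \<Rightarrow> ennreal" where
  "psi p f z = (\<integral>\<^sup>+ x. laplace_p p (translate z f) x \<partial>lborel)"

(* convex_on is for real-valued functions; this is convexity for values in [0,\<infinity>].
   The convention 0 * \<infinity> = 0 makes the cases u = 0 and v = 0 trivial. *)
definition convex_ennreal :: "('a::real_vector \<Rightarrow> ennreal) \<Rightarrow> bool" where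
  "convex_ennreal h \<longleftrightarrow>
     (\<forall>x y. \<forall>u\<ge>0. \<forall>v\<ge>0. u + v = 1 \<longrightarrow>
        h (u *\<^sub>R x + v *\<^sub>R y) \<le> ennreal u * h x + ennreal v * h y)"

definition has_barycenter :: "('a::euclidean_space \<Rightarrow> ennreal) \<Rightarrow> bool" where
  "has_barycenter g \<longleftrightarrow>
     0 < (\<integral>\<^sup>+ x. ennreal (1 + norm x) * g x \<partial>lborel) \<and>
     (\<integral>\<^sup>+ x. ennreal (1 + norm x) * g x \<partial>lborel) < \<infinity>"

(* Only meaningful under has_barycenter g; then g is finite almost everywhere,
   so that enn2real loses nothing. *)
definition barycenter :: "('a::euclidean_space \<Rightarrow> ennreal) \<Rightarrow> 'a" where
  "barycenter g =
     (\<integral>x. enn2real (g x) *\<^sub>R x \<partial>lborel) /\<^sub>R (\<integral>x. enn2real (g x) \<partial>lborel)"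

definition is_minimizer :: "('a \<Rightarrow> 'b::order) \<Rightarrow> 'a \<Rightarrow> bool" where
  "is_minimizer h s \<longleftrightarrow> (\<forall>z. h s \<le> h z)"

(* The point s_p(f); only meaningful when psi p f has exactly one minimizer. *)
definition s_point :: "real \<Rightarrow> ('a::euclidean_space \<Rightarrow> real) \<Rightarrow> 'a" where
  "s_point p f = (THE s. is_minimizer (psi p f) s)"

end

theory Submission
  imports Defs
begin

text \<open>
  Write \<open>G = laplace_p p f\<close>, the \<open>q\<close>-th power of the Laplace transform of \<open>f powr (1 / p)\<close>. A
  translation of \<open>f\<close> multiplies \<open>G\<close> by an exponential, so \<open>psi p f z\<close> is the Laplace transform of
  \<open>G\<close> at \<open>q z\<close>; this gives the two formulas and convexity. Laplace transforms are log-convex and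
  \<open>q < 0\<close>, hence \<open>G\<close> is log-concave, and the question becomes how the Laplace transform of a
  log-concave function behaves.

  Everything about existence and finiteness rests on one estimate (\<open>laplace_exp_growth\<close>): if a
  nonnegative function has positive mass in every open half-space with the origin on its boundary,
  then its Laplace transform grows exponentially in all directions. Applied to \<open>f powr (1 / p)\<close>, recentred at
  the barycenter of a bounded piece of its support, it shows that \<open>G\<close> times a suitable exponential
  decays exponentially; this is properness. Applied to \<open>G\<close>, it makes \<open>psi p f\<close> coercive, and
  since \<open>psi p f\<close> is lower semicontinuous by Fatou's lemma, it attains its minimum. If instead \<open>G\<close>
  has no mass in some half-space, then \<open>psi p f\<close> tends to 0 along the corresponding direction and
  the infimum is 0 (\<open>laplace_INF_eq_0_if_halfspace_null\<close>).

  A vanishing barycenter forces a strict minimum, by integrating \<open>1 + t \<le> exp t\<close>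
  (\<open>laplace_strict_min_if_centered\<close>). Conversely, a minimizer has vanishing barycenter by the
  first-order condition (\<open>centered_if_laplace_min\<close>). This is where log-concavity is essential: an
  integrable log-concave function decays exponentially (\<open>log_concave_exp_moment\<close>), so that the
  barycenter exists and perturbing the exponent is harmless. Without it, the Laplace transform could
  be finite at a single point only, with no first moment there. Both directions together give
  uniqueness as well.
\<close>

section \<open>The Laplace transform\<close>

lemma nn_integral_lborel_affine:
  fixes F :: "'a::euclidean_space \<Rightarrow> ennreal"
  assumes [measurable]: "F \<in> borel_measurable borel" and c: "c \<noteq> 0"
  shows "(\<integral>\<^sup>+ x. F x \<partial>lborel) = ennreal (\<bar>c\<bar> ^ DIM('a)) * (\<integral>\<^sup>+ x. F (t + c *\<^sub>R x) \<partial>lborel)"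
  by (subst lborel_affine[OF c, of t])
     (simp add: nn_integral_density nn_integral_distr nn_integral_cmult)

lemma laplace_measurable[measurable]:
  fixes g :: "'a::euclidean_space \<Rightarrow> ennreal"
  assumes [measurable]: "g \<in> borel_measurable borel"
  shows "laplace g \<in> borel_measurable borel"
  unfolding laplace_def by measurable

lemma laplace_translate:
  fixes g :: "'a::euclidean_space \<Rightarrow> ennreal"
  assumes [measurable]: "g \<in> borel_measurable borel"
  shows "laplace (translate z g) y = ennreal (exp (z \<bullet> y)) * laplace g y"
proof -
  have [measurable]: "translate z g \<in> borel_measurable borel"
    unfolding translate_def by measurable
  have "laplace (translate z g) y = (\<integral>\<^sup>+ x. ennreal (exp (z \<bullet> y)) * (g x * ennreal (exp (x \<bullet> y))) \<partial>lborel)"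
    unfolding laplace_def
    by (subst nn_integral_lborel_affine[of _ 1 z])
       (simp_all add: translate_def inner_add_left exp_add ennreal_mult ac_simps)
  also have "\<dots> = ennreal (exp (z \<bullet> y)) * laplace g y"
    unfolding laplace_def by (rule nn_integral_cmult) measurable
  finally show ?thesis .
qed

text \<open>
  The exponential is convex, and convexity survives integration against \<open>g\<close>.
\<close>

lemma laplace_convex:
  fixes g :: "'a::euclidean_space \<Rightarrow> ennreal"
  assumes [measurable]: "g \<in> borel_measurable borel"
  shows "convex_ennreal (laplace g)"
  unfolding convex_ennreal_def
proof (intro allI impI)
  fix x y :: 'a and u v :: real
  assume uv: "0 \<le> u" "0 \<le> v" "u + v = 1"
  have "g t * ennreal (exp (t \<bullet> (u *\<^sub>R x + v *\<^sub>R y)))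
      \<le> ennreal u * (g t * ennreal (exp (t \<bullet> x))) + ennreal v * (g t * ennreal (exp (t \<bullet> y)))" for t
  proof -
    have "exp (t \<bullet> (u *\<^sub>R x + v *\<^sub>R y)) \<le> u * exp (t \<bullet> x) + v * exp (t \<bullet> y)"
      using convex_onD[OF exp_convex, of v "t \<bullet> x" "t \<bullet> y"] uv
      by (simp add: inner_add_right eq_diff_eq[symmetric])
    then have "ennreal (exp (t \<bullet> (u *\<^sub>R x + v *\<^sub>R y)))
      \<le> ennreal u * ennreal (exp (t \<bullet> x)) + ennreal v * ennreal (exp (t \<bullet> y))"
      using uv by (simp flip: ennreal_mult ennreal_plus)
    then have "g t * ennreal (exp (t \<bullet> (u *\<^sub>R x + v *\<^sub>R y)))
      \<le> g t * (ennreal u * ennreal (exp (t \<bullet> x)) + ennreal v * ennreal (exp (t \<bullet> y)))"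
      by (rule mult_left_mono) simp
    then show ?thesis by (simp add: distrib_left ac_simps)
  qed
  then have "laplace g (u *\<^sub>R x + v *\<^sub>R y)
     \<le> (\<integral>\<^sup>+ t. ennreal u * (g t * ennreal (exp (t \<bullet> x))) + ennreal v * (g t * ennreal (exp (t \<bullet> y))) \<partial>lborel)"
    unfolding laplace_def by (intro nn_integral_mono) 
  also have "\<dots> = ennreal u * laplace g x + ennreal v * laplace g y"
    unfolding laplace_def by (simp add: nn_integral_add nn_integral_cmult)
  finally show "laplace g (u *\<^sub>R x + v *\<^sub>R y) \<le> ennreal u * laplace g x + ennreal v * laplace g y" .
qed

text \<open>
  This is Hoelder's inequality, obtained from convexity of \<open>exp\<close> alone: after subtracting \<open>ln A\<close> and
  \<open>ln B\<close> in the exponents, the convex combination of the two normalized integrals is exactly 1.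
\<close>

lemma laplace_log_convex:
  fixes g :: "'a::euclidean_space \<Rightarrow> ennreal"
  assumes [measurable]: "g \<in> borel_measurable borel"
    and A: "laplace g x = ennreal A" "0 < A" and B: "laplace g y = ennreal B" "0 < B"
    and uv: "0 \<le> u" "0 \<le> v" "u + v = 1"
  shows "laplace g (u *\<^sub>R x + v *\<^sub>R y) \<le> ennreal (A powr u * B powr v)"
proof -
  define C where "C = A powr u * B powr v"
  have C: "C = exp (u * ln A + v * ln B)" "0 < C"
    using A B by (simp_all add: C_def powr_def exp_add)
  have "g t * ennreal (exp (t \<bullet> (u *\<^sub>R x + v *\<^sub>R y)))
      \<le> ennreal (C * u / A) * (g t * ennreal (exp (t \<bullet> x))) + ennreal (C * v / B) * (g t * ennreal (exp (t \<bullet> y)))" for t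
  proof -
    have "exp (t \<bullet> (u *\<^sub>R x + v *\<^sub>R y)) = C * exp (u * (t \<bullet> x - ln A) + v * (t \<bullet> y - ln B))"
      unfolding C by (simp add: inner_add_right algebra_simps flip: exp_add)
    also have "\<dots> \<le> C * (u * exp (t \<bullet> x - ln A) + v * exp (t \<bullet> y - ln B))"
      using convex_onD[OF exp_convex, of v "t \<bullet> x - ln A" "t \<bullet> y - ln B"] uv C
      by (intro mult_left_mono) (simp_all add: eq_diff_eq[symmetric])
    also have "\<dots> = C * u / A * exp (t \<bullet> x) + C * v / B * exp (t \<bullet> y)"
      using A B by (simp add: exp_diff field_simps)
    finally have "ennreal (exp (t \<bullet> (u *\<^sub>R x + v *\<^sub>R y)))
      \<le> ennreal (C * u / A) * ennreal (exp (t \<bullet> x)) + ennreal (C * v / B) * ennreal (exp (t \<bullet> y))"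
      using uv A B C(2) by (simp flip: ennreal_mult ennreal_plus)
    then have "g t * ennreal (exp (t \<bullet> (u *\<^sub>R x + v *\<^sub>R y)))
      \<le> g t * (ennreal (C * u / A) * ennreal (exp (t \<bullet> x)) + ennreal (C * v / B) * ennreal (exp (t \<bullet> y)))"
      by (rule mult_left_mono) simp
    then show ?thesis by (simp add: distrib_left ac_simps)
  qed
  then have "laplace g (u *\<^sub>R x + v *\<^sub>R y)
     \<le> (\<integral>\<^sup>+ t. ennreal (C * u / A) * (g t * ennreal (exp (t \<bullet> x))) + ennreal (C * v / B) * (g t * ennreal (exp (t \<bullet> y))) \<partial>lborel)"
    unfolding laplace_def by (intro nn_integral_mono) 
  also have "\<dots> = ennreal (C * u / A) * laplace g x + ennreal (C * v / B) * laplace g y"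
    unfolding laplace_def by (simp add: nn_integral_add nn_integral_cmult)
  also have "\<dots> = ennreal (C * u / A * A + C * v / B * B)"
    using A B uv C(2) by (simp flip: ennreal_mult ennreal_plus)
  also have "C * u / A * A + C * v / B * B = C"
    using A B uv by (simp flip: distrib_left)
  finally show ?thesis unfolding C_def .
qed

section \<open>Mass in half-spaces\<close>

lemma AE_not_in_hyperplane:
  fixes \<theta> :: "'a::euclidean_space"
  assumes "\<theta> \<noteq> 0"
  shows "AE x in lborel. x \<bullet> \<theta> \<noteq> c"
proof -
  have "closed {x. \<theta> \<bullet> x = c}" by (rule closed_hyperplane)
  moreover have "{x. \<theta> \<bullet> x = c} \<in> null_sets lebesgue"
    using negligible_hyperplane[of \<theta> c] assms by (simp add: negligible_iff_null_sets)
  ultimately have "{x. \<theta> \<bullet> x = c} \<in> null_sets lborel"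
    by (simp add: null_sets_completion_iff borel_closed)
  then show ?thesis by (rule AE_I') (auto simp: inner_commute)
qed

text \<open>
  Positive mass in every open half-space with the origin on its boundary becomes uniform by compactness of the
  sphere: some \<open>\<epsilon>\<close> works for all unit vectors \<open>\<theta>\<close> as a lower bound for the mass of
  \<open>{x. \<epsilon> < x \<bullet> \<theta>}\<close>. For \<open>w\<close> in the direction \<open>\<theta>\<close>, the exponent \<open>x \<bullet> w\<close>
  is at least \<open>\<epsilon> * norm w\<close> there. The bound is used twice, for coercivity of \<open>psi p f\<close> and for decay of \<open>laplace_p p f\<close>.
\<close>

lemma laplace_exp_growth:
  fixes h :: "'a::euclidean_space \<Rightarrow> ennreal"
  assumes [measurable]: "h \<in> borel_measurable borel"
    and half: "\<And>\<theta>. \<theta> \<noteq> 0 \<Longrightarrow> (\<integral>\<^sup>+ x. h x * indicator {x. 0 < x \<bullet> \<theta>} x \<partial>lborel) \<noteq> 0"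
  shows "\<exists>\<epsilon>>0. \<forall>w. ennreal (\<epsilon> * exp (\<epsilon> * norm w)) \<le> laplace h w"
proof -
  define I where "I \<epsilon> \<theta> = (\<integral>\<^sup>+ x. h x * indicator {x. \<epsilon> < x \<bullet> \<theta>} x \<partial>lborel)" for \<epsilon> \<theta>
  \<comment> \<open>If the mass could become arbitrarily small, Fatou's lemma would give a
    limiting direction whose open half-space has no mass.\<close>
  have "\<exists>\<epsilon>>0. \<forall>\<theta>. norm \<theta> = 1 \<longrightarrow> ennreal \<epsilon> \<le> I \<epsilon> \<theta>"
  proof (rule ccontr)
    assume "\<not> ?thesis"
    then have "\<exists>\<theta>. norm \<theta> = 1 \<and> I (1 / real (Suc k)) \<theta> < ennreal (1 / real (Suc k))" for k
      by (metis not_le zero_less_divide_1_iff of_nat_0_less_iff zero_less_Suc)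
    then obtain \<theta> where \<theta>: "\<And>k. norm (\<theta> k) = 1" "\<And>k. I (1 / real (Suc k)) (\<theta> k) < ennreal (1 / real (Suc k))"
      by metis
    have "compact (sphere (0::'a) 1)" by simp
    then obtain l r where l: "l \<in> sphere 0 1" and r: "strict_mono (r :: nat \<Rightarrow> nat)" and lim: "(\<theta> \<circ> r) \<longlonglongrightarrow> l"
      using \<theta>(1) unfolding compact_def by (metis mem_sphere_0)
    have to0: "(\<lambda>k. 1 / real (Suc (r k))) \<longlonglongrightarrow> 0"
      using LIMSEQ_subseq_LIMSEQ[OF LIMSEQ_inverse_real_of_nat r] by (simp add: o_def inverse_eq_divide)
    have "I 0 l \<le> (\<integral>\<^sup>+ x. liminf (\<lambda>k. h x * indicator {x. 1 / real (Suc (r k)) < x \<bullet> \<theta> (r k)} x) \<partial>lborel)"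
      unfolding I_def
    proof (rule nn_integral_mono)
      fix x
      show "h x * indicator {x. 0 < x \<bullet> l} x \<le> liminf (\<lambda>k. h x * indicator {x. 1 / real (Suc (r k)) < x \<bullet> \<theta> (r k)} x)"
      proof (cases "0 < x \<bullet> l")
        case True
        have "(\<lambda>k. x \<bullet> \<theta> (r k) - 1 / real (Suc (r k))) \<longlonglongrightarrow> x \<bullet> l - 0"
          using lim to0 unfolding o_def by (intro tendsto_intros)
        then have "eventually (\<lambda>k. 0 < x \<bullet> \<theta> (r k) - 1 / real (Suc (r k))) sequentially"
          using True by (intro order_tendstoD(1)) simp_all
        then show ?thesis
          using True by (intro Liminf_bounded) (elim eventually_mono, simp)
      qed simp
    qed
    also have "\<dots> \<le> liminf (\<lambda>k. I (1 / real (Suc (r k))) (\<theta> (r k)))"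
      unfolding I_def by (rule nn_integral_liminf) measurable
    also have "\<dots> \<le> liminf (\<lambda>k. ennreal (1 / real (Suc (r k))))"
      using \<theta>(2) by (intro Liminf_mono always_eventually allI less_imp_le)
    also have "\<dots> = 0"
      using tendsto_ennrealI[OF to0] by (intro lim_imp_Liminf) auto
    finally have "I 0 l = 0" by simp
    moreover have "l \<noteq> 0" using l by auto
    ultimately show False using half[of l] unfolding I_def by simp
  qed
  then obtain \<epsilon> where \<epsilon>: "0 < \<epsilon>" "\<And>\<theta>. norm \<theta> = 1 \<Longrightarrow> ennreal \<epsilon> \<le> I \<epsilon> \<theta>" by blast
  have "ennreal (\<epsilon> * exp (\<epsilon> * norm w)) \<le> laplace h w" for w
  proof -
    obtain \<theta> where \<theta>: "norm \<theta> = 1" "w = norm w *\<^sub>R \<theta>"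
    proof (cases "w = 0")
      case True
      then show ?thesis using that[of "SOME i. i \<in> Basis"] SOME_Basis norm_Basis by auto
    next
      case False
      then show ?thesis using that[of "w /\<^sub>R norm w"] by simp
    qed
    have "ennreal (\<epsilon> * exp (\<epsilon> * norm w)) \<le> ennreal (exp (\<epsilon> * norm w)) * I \<epsilon> \<theta>"
      using \<epsilon>(1) mult_left_mono[OF \<epsilon>(2)[OF \<theta>(1)], of "ennreal (exp (\<epsilon> * norm w))"]
      by (simp add: mult.commute flip: ennreal_mult)
    also have "\<dots> = (\<integral>\<^sup>+ x. ennreal (exp (\<epsilon> * norm w)) * (h x * indicator {x. \<epsilon> < x \<bullet> \<theta>} x) \<partial>lborel)"
      unfolding I_def by (rule nn_integral_cmult[symmetric]) measurable
    also have "\<dots> \<le> laplace h w"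
      unfolding laplace_def
    proof (rule nn_integral_mono)
      fix x
      show "ennreal (exp (\<epsilon> * norm w)) * (h x * indicator {x. \<epsilon> < x \<bullet> \<theta>} x) \<le> h x * ennreal (exp (x \<bullet> w))"
      proof (cases "\<epsilon> < x \<bullet> \<theta>")
        case True
        have "\<epsilon> * norm w \<le> norm w * (x \<bullet> \<theta>)"
          using mult_left_mono[of \<epsilon> "x \<bullet> \<theta>" "norm w"] True by (simp add: mult.commute)
        also have "\<dots> = x \<bullet> w" by (subst (2) \<theta>(2)) simp
        finally have "ennreal (exp (\<epsilon> * norm w)) \<le> ennreal (exp (x \<bullet> w))" by (simp add: ennreal_leI)
        then show ?thesis using True by (simp add: mult.commute mult_left_mono)
      qed simp
    qed
    finally show ?thesis .
  qed
  with \<epsilon>(1) show ?thesis by blast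
qed

lemma laplace_lower_semicontinuous:
  fixes h :: "'a::euclidean_space \<Rightarrow> ennreal"
  assumes [measurable]: "h \<in> borel_measurable borel" and w: "w \<longlonglongrightarrow> l"
  shows "laplace h l \<le> liminf (\<lambda>k. laplace h (w k))"
proof -
  have "(\<lambda>k. h x * ennreal (exp (x \<bullet> w k))) \<longlonglongrightarrow> h x * ennreal (exp (x \<bullet> l))" for x
    using w by (intro tendsto_mult_ennreal tendsto_ennrealI tendsto_intros tendsto_const) auto
  then have "liminf (\<lambda>k. h x * ennreal (exp (x \<bullet> w k))) = h x * ennreal (exp (x \<bullet> l))" for x
    by (intro lim_imp_Liminf) auto
  then show ?thesis
    unfolding laplace_def
    using nn_integral_liminf[of "\<lambda>k x. h x * ennreal (exp (x \<bullet> w k))" lborel] by simp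
qed

text \<open>
  The growth bound confines a minimizing sequence to a ball, and a limit of a subsequence is a
  minimizer by lower semicontinuity.
\<close>

lemma laplace_attains_minimum:
  fixes h :: "'a::euclidean_space \<Rightarrow> ennreal"
  assumes [measurable]: "h \<in> borel_measurable borel"
    and half: "\<And>\<theta>. \<theta> \<noteq> 0 \<Longrightarrow> (\<integral>\<^sup>+ x. h x * indicator {x. 0 < x \<bullet> \<theta>} x \<partial>lborel) \<noteq> 0"
    and fin: "laplace h w0 < \<infinity>"
  shows "\<exists>s. is_minimizer (laplace h) s"
proof -
  obtain \<epsilon> where \<epsilon>: "0 < \<epsilon>" "\<And>w. ennreal (\<epsilon> * exp (\<epsilon> * norm w)) \<le> laplace h w"
    using laplace_exp_growth[OF assms(1) half] by blast
  define m where "m = (INF w. laplace h w)"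
  have "m < \<infinity>" unfolding m_def using fin by (auto intro: le_less_trans[OF INF_lower])
  then obtain M where M: "m = ennreal M" "0 \<le> M" by (cases m) auto
  have "\<exists>w. laplace h w < ennreal (M + 1 / real (Suc k))" for k
  proof -
    have "m < ennreal (M + 1 / real (Suc k))" unfolding M(1) using M(2) by (simp add: ennreal_lessI add_nonneg_pos)
    then show ?thesis unfolding m_def by (auto simp: INF_less_iff)
  qed
  then obtain w where w: "\<And>k. laplace h (w k) < ennreal (M + 1 / real (Suc k))" by metis
  \<comment> \<open>By the growth bound, with \<open>t \<le> exp t\<close> for \<open>t = \<epsilon> * norm (w k)\<close>.\<close>
  have bnd: "norm (w k) \<le> (M + 1) / \<epsilon>\<^sup>2" for k
  proof -
    have "ennreal (\<epsilon> * exp (\<epsilon> * norm (w k))) \<le> ennreal (M + 1 / real (Suc k))"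
      using \<epsilon>(2) w by (metis order.strict_implies_order order.trans)
    then have "\<epsilon> * exp (\<epsilon> * norm (w k)) \<le> M + 1 / real (Suc k)"
      using M(2) by (subst (asm) ennreal_le_iff) auto
    also have "\<dots> \<le> M + 1" by simp
    finally have 1: "\<epsilon> * exp (\<epsilon> * norm (w k)) \<le> M + 1" .
    have "\<epsilon> * norm (w k) \<le> exp (\<epsilon> * norm (w k))"
      using exp_ge_add_one_self[of "\<epsilon> * norm (w k)"] by linarith
    then have "\<epsilon> * (\<epsilon> * norm (w k)) \<le> M + 1"
      using 1 \<epsilon>(1) by (meson mult_left_mono less_imp_le order.trans)
    then show ?thesis using \<epsilon>(1) by (simp add: field_simps power2_eq_square)
  qed
  then have "\<forall>k. w k \<in> cball 0 ((M + 1) / \<epsilon>\<^sup>2)" by simp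
  moreover have "compact (cball (0::'a) ((M + 1) / \<epsilon>\<^sup>2))" by simp
  ultimately obtain s r where r: "strict_mono (r :: nat \<Rightarrow> nat)" and lim: "(w \<circ> r) \<longlonglongrightarrow> s"
    unfolding compact_def by metis
  have to0: "(\<lambda>k. 1 / real (Suc (r k))) \<longlonglongrightarrow> 0"
    using LIMSEQ_subseq_LIMSEQ[OF LIMSEQ_inverse_real_of_nat r] by (simp add: o_def inverse_eq_divide)
  have "laplace h s \<le> liminf (\<lambda>k. laplace h (w (r k)))"
    using laplace_lower_semicontinuous[OF assms(1) lim] by simp
  also have "\<dots> \<le> liminf (\<lambda>k. ennreal (M + 1 / real (Suc (r k))))"
    using w by (intro Liminf_mono always_eventually allI less_imp_le)
  also have "\<dots> = m"
    using tendsto_ennrealI[OF tendsto_add[OF tendsto_const[of M] to0]] M by (intro lim_imp_Liminf) auto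
  finally show ?thesis
    unfolding is_minimizer_def m_def by (meson order.trans INF_lower UNIV_I)
qed

text \<open>
  As \<open>w\<close> moves to infinity in the direction of an empty open half-space, the integrand decreases to
  0 on the opposite one, and the hyperplane between them is a null set; dominated convergence
  applies.
\<close>

lemma laplace_INF_eq_0_if_halfspace_null:
  fixes h :: "'a::euclidean_space \<Rightarrow> ennreal"
  assumes [measurable]: "h \<in> borel_measurable borel"
    and \<theta>: "\<theta> \<noteq> 0" and null: "(\<integral>\<^sup>+ x. h x * indicator {x. 0 < x \<bullet> \<theta>} x \<partial>lborel) = 0"
    and fin: "laplace h w0 < \<infinity>"
  shows "(INF w. laplace h w) = 0"
proof -
  define u where "u k x = h x * ennreal (exp (x \<bullet> (w0 + real k *\<^sub>R \<theta>)))" for k x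
  have "AE x in lborel. h x * indicator {x. 0 < x \<bullet> \<theta>} x = 0"
    using null by (subst (asm) nn_integral_0_iff_AE) measurable
  moreover have "AE x in lborel. h x * ennreal (exp (x \<bullet> w0)) \<noteq> \<infinity>"
    using fin unfolding laplace_def by (intro nn_integral_noteq_infinite) auto
  ultimately have ae: "AE x in lborel. h x = 0 \<or> (h x \<noteq> \<infinity> \<and> x \<bullet> \<theta> < 0)"
    using AE_not_in_hyperplane[OF \<theta>, of 0]
    by eventually_elim (auto split: split_indicator_asm simp: ennreal_top_mult)
  have "(\<lambda>k. integral\<^sup>N lborel (u k)) \<longlonglongrightarrow> (\<integral>\<^sup>+ (x::'a). 0 \<partial>lborel)"
  proof (rule nn_integral_dominated_convergence[where w = "\<lambda>x. h x * ennreal (exp (x \<bullet> w0))"])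
    show "u k \<in> borel_measurable lborel" for k unfolding u_def by measurable
    show "(\<integral>\<^sup>+ x. h x * ennreal (exp (x \<bullet> w0)) \<partial>lborel) < \<infinity>" using fin unfolding laplace_def .
    show "AE x in lborel. u k x \<le> h x * ennreal (exp (x \<bullet> w0))" for k
      using ae
    proof eventually_elim
      case (elim x)
      have "ennreal (exp (x \<bullet> (w0 + real k *\<^sub>R \<theta>))) \<le> ennreal (exp (x \<bullet> w0))" if "x \<bullet> \<theta> < 0"
        using that by (intro ennreal_leI) (simp add: inner_add_right mult_nonneg_nonpos)
      then show ?case using elim by (auto simp: u_def intro: mult_left_mono)
    qed
    show "AE x in lborel. (\<lambda>k. u k x) \<longlonglongrightarrow> 0"
      using ae
    proof eventually_elim
      case (elim x)
      show ?case
      proof (cases "h x = 0")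
        case False
        with elim have x: "h x \<noteq> \<infinity>" "x \<bullet> \<theta> < 0" by auto
        have "filterlim (\<lambda>k. x \<bullet> w0 + (x \<bullet> \<theta>) * real k) at_bot sequentially"
          using filterlim_tendsto_neg_mult_at_bot[OF tendsto_const x(2) filterlim_real_sequentially]
          by (simp add: filterlim_tendsto_add_at_bot_iff[OF tendsto_const])
        then have "(\<lambda>k. exp (x \<bullet> w0 + (x \<bullet> \<theta>) * real k)) \<longlonglongrightarrow> 0"
          by (rule filterlim_compose[OF exp_at_bot])
        then have "(\<lambda>k. ennreal (exp (x \<bullet> (w0 + real k *\<^sub>R \<theta>)))) \<longlonglongrightarrow> ennreal 0"
          by (intro tendsto_ennrealI) (simp add: inner_add_right mult.commute)
        then have "(\<lambda>k. h x * ennreal (exp (x \<bullet> (w0 + real k *\<^sub>R \<theta>)))) \<longlonglongrightarrow> h x * ennreal 0"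
          using x(1) by (intro tendsto_mult_ennreal tendsto_const) auto
        then show ?thesis by (simp add: u_def)
      qed (simp add: u_def)
    qed
  qed simp_all
  then have "(\<lambda>k. laplace h (w0 + real k *\<^sub>R \<theta>)) \<longlonglongrightarrow> 0"
    by (simp add: laplace_def u_def[abs_def])
  then have "(INF w. laplace h w) \<le> 0"
    by (rule LIMSEQ_le_const) (auto intro: INF_lower)
  then show ?thesis by simp
qed

lemma bounded_superlevel_set_positive:
  fixes G :: "'a::euclidean_space \<Rightarrow> real"
  assumes [measurable]: "G \<in> borel_measurable borel"
    and pos: "emeasure lborel {x. 0 < G x} \<noteq> 0"
  shows "\<exists>\<delta>>0. \<exists>R\<ge>0. emeasure lborel ({x. \<delta> \<le> G x} \<inter> cball 0 R) \<noteq> 0"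
proof (rule ccontr)
  assume "\<not> ?thesis"
  then have null: "{x. 1 / real (Suc k) \<le> G x} \<inter> cball 0 (real k) \<in> null_sets lborel" for k
    by (simp add: null_sets_def)
  have "{x. 0 < G x} \<subseteq> (\<Union>k. {x. 1 / real (Suc k) \<le> G x} \<inter> cball 0 (real k))"
  proof
    fix x assume "x \<in> {x. 0 < G x}"
    then obtain n where n: "1 / real (Suc n) < G x" using nat_approx_posE by blast
    define k where "k = max n (nat \<lceil>norm x\<rceil>)"
    have "norm x \<le> real k" unfolding k_def by linarith
    moreover have "1 / real (Suc k) \<le> 1 / real (Suc n)" unfolding k_def by (simp add: field_simps)
    ultimately show "x \<in> (\<Union>k. {x. 1 / real (Suc k) \<le> G x} \<inter> cball 0 (real k))"
      using n by (intro UN_I[of k]) auto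
  qed
  moreover have "(\<Union>k. {x. 1 / real (Suc k) \<le> G x} \<inter> cball 0 (real k)) \<in> null_sets lborel"
    using null by (intro null_sets_UN) auto
  ultimately have "{x. 0 < G x} \<in> null_sets lborel"
    by (rule null_sets_subset[rotated 2]) measurable
  then show False using pos by (simp add: null_sets_def)
qed

text \<open>
  The point \<open>b\<close> is the barycenter of a bounded set \<open>K\<close> of positive measure on which \<open>f\<close>, and hence
  \<open>g\<close>, is positive. An open half-space bounded by a hyperplane through \<open>b\<close> that misses almost all of \<open>K\<close>
  would force \<open>K\<close> into the hyperplane itself, up to a null set.
\<close>

lemma exists_center_halfspaces:
  fixes f :: "'a::euclidean_space \<Rightarrow> real" and g :: "'a \<Rightarrow> ennreal"
  assumes [measurable]: "f \<in> borel_measurable borel" "g \<in> borel_measurable borel"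
    and pos: "emeasure lborel {x. 0 < f x} \<noteq> 0"
    and supp: "\<And>x. 0 < f x \<Longrightarrow> g x \<noteq> 0"
  shows "\<exists>b. \<forall>\<theta>. \<theta> \<noteq> 0 \<longrightarrow>
           (\<integral>\<^sup>+ x. translate (- b) g x * indicator {x. 0 < x \<bullet> \<theta>} x \<partial>lborel) \<noteq> 0"
proof -
  obtain \<delta> R where \<delta>: "0 < \<delta>" and "emeasure lborel ({x. \<delta> \<le> f x} \<inter> cball 0 R) \<noteq> 0"
    using bounded_superlevel_set_positive[OF assms(1) pos] by blast
  moreover define K where "K = {x. \<delta> \<le> f x} \<inter> cball 0 R"
  ultimately have K: "emeasure lborel K \<noteq> 0" by simp
  have [measurable]: "K \<in> sets borel" unfolding K_def by measurable
  have "emeasure lborel K \<le> emeasure lborel (cball (0::'a) R)"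
    by (rule emeasure_mono) (auto simp: K_def)
  also have "\<dots> < \<infinity>" by (rule emeasure_bounded_finite) simp
  finally have fin: "emeasure lborel K < \<infinity>" .
  define \<mu> where "\<mu> = measure lborel K"
  have \<mu>: "\<mu> \<noteq> 0" using K fin unfolding \<mu>_def measure_def by (simp add: enn2real_eq_0_iff less_top)
  have int1: "integrable lborel (indicator K :: 'a \<Rightarrow> real)" using fin by simp
  have intx: "integrable lborel (\<lambda>x. indicator K x *\<^sub>R x)"
  proof (rule Bochner_Integration.integrable_bound)
    show "integrable lborel (\<lambda>x. R * indicator K x)" using int1 by simp
    show "AE x in lborel. norm (indicator K x *\<^sub>R x) \<le> norm (R * indicator K x)"
      by (rule AE_I2) (auto simp: K_def split: split_indicator)
  qed measurable
  define b where "b = (\<integral>x. indicator K x *\<^sub>R x \<partial>lborel) /\<^sub>R \<mu>"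
  have "(\<integral>\<^sup>+ x. translate (- b) g x * indicator {x. 0 < x \<bullet> \<theta>} x \<partial>lborel) \<noteq> 0" if \<theta>: "\<theta> \<noteq> 0" for \<theta>
  proof
    assume "(\<integral>\<^sup>+ x. translate (- b) g x * indicator {x. 0 < x \<bullet> \<theta>} x \<partial>lborel) = 0"
    moreover have "(\<integral>\<^sup>+ y. g y * indicator {x. 0 < (x - b) \<bullet> \<theta>} y \<partial>lborel)
       = (\<integral>\<^sup>+ x. translate (- b) g x * indicator {x. 0 < x \<bullet> \<theta>} x \<partial>lborel)"
      by (subst nn_integral_lborel_affine[of _ 1 b]) (auto simp: translate_def add.commute indicator_def intro!: nn_integral_cong)
    ultimately have "(\<integral>\<^sup>+ y. g y * indicator {x. 0 < (x - b) \<bullet> \<theta>} y \<partial>lborel) = 0" by simp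
    then have "AE y in lborel. g y * indicator {x. 0 < (x - b) \<bullet> \<theta>} y = 0"
      by (subst (asm) nn_integral_0_iff_AE) auto
    then have le: "AE y in lborel. 0 \<le> - (indicator K y * ((y - b) \<bullet> \<theta>))"
    proof eventually_elim
      case (elim y)
      show ?case
      proof (cases "y \<in> K")
        case True
        then have "g y \<noteq> 0" using supp \<delta> by (auto simp: K_def)
        then show ?thesis using elim True by (auto split: split_indicator_asm)
      qed simp
    qed
    \<comment> \<open>Almost everywhere nonnegative and, by the choice of \<open>b\<close>, has integral 0.\<close>
    have eq: "- (indicator K y * ((y - b) \<bullet> \<theta>)) = indicator K y * (b \<bullet> \<theta>) - (indicator K y *\<^sub>R y) \<bullet> \<theta>" for y
      by (simp add: inner_diff_left algebra_simps)
    have int: "integrable lborel (\<lambda>y. - (indicator K y * ((y - b) \<bullet> \<theta>)))"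
      unfolding eq using int1 intx
      by (intro Bochner_Integration.integrable_diff integrable_inner_left integrable_mult_left) auto
    have "(\<integral>y. - (indicator K y * ((y - b) \<bullet> \<theta>)) \<partial>lborel)
        = (\<integral>y. indicator K y * (b \<bullet> \<theta>) \<partial>lborel) - (\<integral>y. (indicator K y *\<^sub>R y) \<bullet> \<theta> \<partial>lborel)"
      unfolding eq using int1 intx
      by (intro Bochner_Integration.integral_diff integrable_inner_left integrable_mult_left) auto
    also have "\<dots> = \<mu> * (b \<bullet> \<theta>) - (\<integral>y. indicator K y *\<^sub>R y \<partial>lborel) \<bullet> \<theta>"
      using intx fin by (simp add: integral_inner_left \<mu>_def del: inner_scaleR_left)
    also have "\<dots> = 0" using \<mu> by (simp add: b_def)
    finally have "AE y in lborel. - (indicator K y * ((y - b) \<bullet> \<theta>)) = 0"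
      using integral_nonneg_eq_0_iff_AE[OF int le] by simp
    then have "AE y in lborel. y \<notin> K"
      using AE_not_in_hyperplane[OF \<theta>, of "b \<bullet> \<theta>"]
      by eventually_elim (auto simp: inner_diff_left)
    then show False using K by (subst (asm) AE_iff_measurable[OF _ refl]) auto
  qed
  then show ?thesis by blast
qed

section \<open>Exponential decay of log-concave functions\<close>

lemma nn_integral_exp_minus_abs:
  fixes d :: real
  assumes "0 < d"
  shows "(\<integral>\<^sup>+ t. ennreal (exp (- (d * \<bar>t\<bar>))) \<partial>lborel) < \<infinity>"
proof -
  define F where "F t = ennreal (exp (- (d * t))) * indicator {0..} t" for t :: real
  have F[measurable]: "F \<in> borel_measurable borel" unfolding F_def by measurable
  have "(\<integral>\<^sup>+ t. F t \<partial>lborel) = ennreal (0 - (- exp (- (d * 0)) / d))"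
    unfolding F_def
  proof (rule nn_integral_FTC_atLeast)
    have "filterlim (\<lambda>t. - (d * t)) at_bot at_top"
      using filterlim_tendsto_pos_mult_at_top[OF tendsto_const assms filterlim_ident]
      by (simp add: filterlim_uminus_at_top)
    then have "((\<lambda>t. - exp (- (d * t)) / d) \<longlongrightarrow> - 0 / d) at_top"
      using assms by (intro tendsto_intros filterlim_compose[OF exp_at_bot]) auto
    then show "((\<lambda>t. - exp (- (d * t)) / d) \<longlongrightarrow> 0) at_top" by simp
  qed (use assms in \<open>auto intro!: derivative_eq_intros\<close>)
  then have fin: "(\<integral>\<^sup>+ t. F t \<partial>lborel) < \<infinity>" by simp
  have "(\<integral>\<^sup>+ t. ennreal (exp (- (d * \<bar>t\<bar>))) \<partial>lborel) \<le> (\<integral>\<^sup>+ t. F t + F (0 + - 1 * t) \<partial>lborel)"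
    by (intro nn_integral_mono) (auto simp: F_def split: split_indicator)
  also have "\<dots> = (\<integral>\<^sup>+ t. F t \<partial>lborel) + (\<integral>\<^sup>+ t. F t \<partial>lborel)"
    using nn_integral_real_affine[OF F, of "-1" 0] by (subst nn_integral_add) auto
  also have "\<dots> < \<infinity>" using fin by simp
  finally show ?thesis .
qed

text \<open>
  The norm dominates the average of the absolute values of the coordinates, which reduces the
  integral to a product of one-dimensional ones.
\<close>

lemma nn_integral_exp_minus_norm:
  fixes c :: real
  assumes "0 < c"
  shows "(\<integral>\<^sup>+ x. ennreal (exp (- (c * norm x))) \<partial>(lborel :: 'a::euclidean_space measure)) < \<infinity>"
proof -
  define d where "d = c / DIM('a)"
  have d: "0 < d" using assms by (simp add: d_def)
  have "(\<integral>\<^sup>+ x. ennreal (exp (- (c * norm x))) \<partial>(lborel :: 'a measure))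
     \<le> (\<integral>\<^sup>+ x. (\<Prod>b\<in>Basis. ennreal (exp (- (d * \<bar>x \<bullet> b\<bar>)))) \<partial>(lborel :: 'a measure))"
  proof (rule nn_integral_mono)
    fix x :: 'a
    have "(\<Sum>b\<in>Basis. \<bar>x \<bullet> b\<bar>) \<le> (\<Sum>b\<in>(Basis::'a set). norm x)"
      by (intro sum_mono) (rule Basis_le_norm)
    then have "d * (\<Sum>b\<in>Basis. \<bar>x \<bullet> b\<bar>) \<le> d * (DIM('a) * norm x)"
      using d by (intro mult_left_mono) auto
    also have "\<dots> = c * norm x" by (simp add: d_def)
    finally have "exp (- (c * norm x)) \<le> exp (\<Sum>b\<in>Basis. - (d * \<bar>x \<bullet> b\<bar>))"
      by (simp add: sum_negf sum_distrib_left)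
    also have "\<dots> = (\<Prod>b\<in>Basis. exp (- (d * \<bar>x \<bullet> b\<bar>)))" by (rule exp_sum) simp
    finally show "ennreal (exp (- (c * norm x))) \<le> (\<Prod>b\<in>Basis. ennreal (exp (- (d * \<bar>x \<bullet> b\<bar>))))"
      by (simp add: prod_ennreal ennreal_leI)
  qed
  also have "\<dots> = (\<Prod>b\<in>(Basis::'a set). (\<integral>\<^sup>+ t. ennreal (exp (- (d * \<bar>t\<bar>))) \<partial>lborel))"
    by (rule nn_integral_lborel_prod) auto
  also have "\<dots> < \<infinity>"
    using nn_integral_exp_minus_abs[OF d] by (simp add: power_less_top_ennreal)
  finally show ?thesis .
qed

text \<open>
  An integrable log-concave function tends to 0 at infinity, since each of its values is controlled
  by its integral over a distant region; log-concavity along rays then turns this into exponential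
  decay.
\<close>

lemma log_concave_exp_moment:
  fixes G :: "'a::euclidean_space \<Rightarrow> real"
  assumes [measurable]: "G \<in> borel_measurable borel"
    and nonneg: "\<And>x. 0 \<le> G x"
    and lc: "\<And>x y u v. 0 < u \<Longrightarrow> 0 < v \<Longrightarrow> u + v = 1 \<Longrightarrow>
               G x powr u * G y powr v \<le> G (u *\<^sub>R x + v *\<^sub>R y)"
    and fin: "(\<integral>\<^sup>+ x. ennreal (G x) \<partial>lborel) < \<infinity>"
    and pos: "(\<integral>\<^sup>+ x. ennreal (G x) \<partial>lborel) \<noteq> 0"
  shows "\<exists>c>0. (\<integral>\<^sup>+ x. ennreal (G x * exp (c * norm x)) \<partial>lborel) < \<infinity>"
proof -
  have "emeasure lborel {x. 0 < G x} \<noteq> 0"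
  proof
    assume "emeasure lborel {x. 0 < G x} = 0"
    then have "AE x in lborel. \<not> 0 < G x" by (subst AE_iff_measurable[OF _ refl]) auto
    then have "AE x in lborel. ennreal (G x) = 0" by eventually_elim (simp add: ennreal_neg)
    then show False using pos by (simp add: nn_integral_0_iff_AE)
  qed
  from bounded_superlevel_set_positive[OF assms(1) this]
  obtain \<delta> R0 where \<delta>: "0 < \<delta>" and R0: "0 \<le> R0"
    and A: "emeasure lborel ({x. \<delta> \<le> G x} \<inter> cball 0 R0) \<noteq> 0"
    by blast
  define A where "A = {x. \<delta> \<le> G x} \<inter> cball 0 R0"
  have [measurable]: "A \<in> sets borel" unfolding A_def by measurable
  have "emeasure lborel A \<le> emeasure lborel (cball (0::'a) R0)"
    by (rule emeasure_mono) (auto simp: A_def)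
  also have "\<dots> < \<infinity>" by (rule emeasure_bounded_finite) simp
  finally obtain \<mu> where \<mu>: "emeasure lborel A = ennreal \<mu>" "0 < \<mu>"
    using assms A unfolding A_def[symmetric] by (cases "emeasure lborel A") (auto simp: le_less)
  then obtain a where a: "a \<in> A" by (cases "A = {}") auto

  define T where "T k = (\<integral>\<^sup>+ y. ennreal (G y) * indicator {y. real k \<le> norm y} y \<partial>lborel)" for k
  have "T \<longlonglongrightarrow> (\<integral>\<^sup>+ (y::'a). 0 \<partial>lborel)"
    unfolding T_def
  proof (rule nn_integral_dominated_convergence[where w = "\<lambda>y. ennreal (G y)"])
    show "AE y in lborel. (\<lambda>k. ennreal (G y) * indicator {y. real k \<le> norm y} y) \<longlonglongrightarrow> 0"
    proof (rule AE_I2)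
      fix y :: 'a
      have "eventually (\<lambda>k. norm y < real k) sequentially"
        using filterlim_real_sequentially unfolding filterlim_at_top_dense by blast
      then show "(\<lambda>k. ennreal (G y) * indicator {y. real k \<le> norm y} y) \<longlonglongrightarrow> 0"
        by (intro tendsto_eventually) (elim eventually_mono, simp)
    qed
  qed (use fin in \<open>auto split: split_indicator\<close>)
  then have T: "T \<longlonglongrightarrow> 0" by simp
  \<comment> \<open>Log-concavity at the midpoint of \<open>x\<close> and each \<open>z \<in> A\<close>, integrated over \<open>z\<close>. For large
    \<open>x\<close> all these midpoints are far out, so the tail of the integral of \<open>G\<close> controls \<open>G x\<close>.\<close>
  have sqrt_bound: "ennreal (\<delta> powr (1/2) * G x powr (1/2) * \<mu>) \<le> 2 ^ DIM('a) * T k"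
    if x: "2 * real k + R0 \<le> norm x" for x k
  proof -
    define F where "F y = ennreal (G y) * indicator {y. real k \<le> norm y} y" for y :: 'a
    have [measurable]: "F \<in> borel_measurable borel" unfolding F_def by measurable
    have "ennreal (\<delta> powr (1/2) * G x powr (1/2) * \<mu>)
        = (\<integral>\<^sup>+ z. ennreal (\<delta> powr (1/2) * G x powr (1/2)) * indicator A z \<partial>lborel)"
      using \<mu> by (subst nn_integral_cmult_indicator) (auto simp: ennreal_mult)
    also have "\<dots> \<le> (\<integral>\<^sup>+ z. F ((1/2) *\<^sub>R x + (1/2) *\<^sub>R z) \<partial>lborel)"
    proof (rule nn_integral_mono)
      fix z
      show "ennreal (\<delta> powr (1/2) * G x powr (1/2)) * indicator A z \<le> F ((1/2) *\<^sub>R x + (1/2) *\<^sub>R z)"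
      proof (cases "z \<in> A")
        case True
        then have z: "\<delta> \<le> G z" "norm z \<le> R0" by (auto simp: A_def)
        have "\<delta> powr (1/2) * G x powr (1/2) \<le> G x powr (1/2) * G z powr (1/2)"
          using z(1) \<delta> by (auto simp: mult.commute[of "\<delta> powr _"] intro!: mult_left_mono powr_mono2)
        also have "\<dots> \<le> G ((1/2) *\<^sub>R x + (1/2) *\<^sub>R z)" by (rule lc) auto
        finally have "ennreal (\<delta> powr (1/2) * G x powr (1/2)) \<le> ennreal (G ((1/2) *\<^sub>R x + (1/2) *\<^sub>R z))"
          by (rule ennreal_leI)
        moreover have "norm x \<le> norm (x + z) + norm z"
          using norm_triangle_ineq4[of "x + z" z] by simp
        then have "real k \<le> norm ((1/2) *\<^sub>R x + (1/2) *\<^sub>R z)"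
          using x z(2) by (simp flip: scaleR_add_right)
        ultimately show ?thesis by (simp add: F_def True)
      qed simp
    qed
    also have "\<dots> = 2 ^ DIM('a) * (ennreal (\<bar>1/2\<bar> ^ DIM('a)) * (\<integral>\<^sup>+ z. F ((1/2) *\<^sub>R x + (1/2) *\<^sub>R z) \<partial>lborel))"
    proof -
      have "2 ^ DIM('a) * ennreal (\<bar>1/2\<bar> ^ DIM('a)) = ennreal (2 ^ DIM('a) * (1/2) ^ DIM('a))"
        by (simp add: ennreal_mult flip: ennreal_power)
      also have "\<dots> = 1" by (simp flip: power_mult_distrib)
      finally show ?thesis by (simp flip: mult.assoc)
    qed
    also have "\<dots> = 2 ^ DIM('a) * T k"
      using nn_integral_lborel_affine[of F "1/2" "(1/2) *\<^sub>R x"] by (simp add: T_def F_def)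
    finally show ?thesis .
  qed

  obtain R where R: "0 < R" "\<And>x. R \<le> norm x \<Longrightarrow> G x \<le> \<delta> * exp (- 1)"
  proof -
    define r where "r = \<delta> powr (1/2) * (\<delta> * exp (- 1)) powr (1/2) * \<mu>"
    have r: "0 < r" unfolding r_def using \<delta> \<mu>(2) by simp
    have "(\<lambda>k. 2 ^ DIM('a) * T k) \<longlonglongrightarrow> 2 ^ DIM('a) * 0"
      using T by (intro tendsto_mult_ennreal tendsto_const) (auto simp: power_eq_top_ennreal)
    then have "eventually (\<lambda>k. 2 ^ DIM('a) * T k < ennreal r) sequentially"
      using r by (intro order_tendstoD(2)) auto
    then obtain k where k: "2 ^ DIM('a) * T k < ennreal r" by (auto dest: eventually_happens)
    have "G x \<le> \<delta> * exp (- 1)" if "2 * real k + R0 + 1 \<le> norm x" for x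
    proof (rule ccontr)
      assume "\<not> ?thesis"
      then have "(\<delta> * exp (- 1)) powr (1/2) \<le> G x powr (1/2)" using \<delta> by (intro powr_mono2) auto
      then have "r \<le> \<delta> powr (1/2) * G x powr (1/2) * \<mu>"
        unfolding r_def using \<delta> \<mu>(2) by (intro mult_right_mono mult_left_mono) auto
      then have "ennreal r \<le> 2 ^ DIM('a) * T k"
        using sqrt_bound[of k x] that by (meson ennreal_leI order.trans add_increasing2 le_add_same_cancel1 zero_le_one)
      then show False using k by simp
    qed
    moreover have "0 < 2 * real k + R0 + 1" using R0 by simp
    ultimately show ?thesis using that by blast
  qed

  define \<rho> where "\<rho> = R + R0"
  have \<rho>: "0 < \<rho>" using R R0 by (simp add: \<rho>_def)
  have Ga: "\<delta> \<le> G a" "norm a \<le> R0" using a by (auto simp: A_def)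
  \<comment> \<open>On the ray from \<open>a\<close> through \<open>x\<close>, \<open>ln G\<close> falls from at least \<open>ln \<delta>\<close> to at most
    \<open>ln \<delta> - 1\<close> over the first distance \<open>\<rho>\<close>; by concavity it keeps falling at least at this rate.\<close>
  have decay: "G x \<le> \<delta> * exp ((R0 - norm x) / \<rho>)" if x: "\<rho> < norm (x - a)" for x
  proof -
    define v where "v = \<rho> / norm (x - a)"
    have v: "0 < v" "v < 1" proof -
      have "0 < norm (x - a)" using x \<rho> by linarith
      then show "0 < v" "v < 1" using x \<rho> by (simp_all add: v_def del: zero_less_norm_iff)
    qed
    define y where "y = (1 - v) *\<^sub>R a + v *\<^sub>R x"
    have "norm (y - a) = \<rho>"
    proof -
      have "y - a = v *\<^sub>R (x - a)" by (simp add: y_def algebra_simps)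
      moreover have "x \<noteq> a" using x \<rho> by auto
      ultimately show ?thesis using \<rho> by (simp add: v_def)
    qed
    then have "R \<le> norm y" using norm_triangle_ineq4[of y a] Ga by (simp add: \<rho>_def)
    have "\<delta> powr (1 - v) * G x powr v \<le> G a powr (1 - v) * G x powr v"
      using Ga \<delta> v by (intro mult_right_mono powr_mono2) auto
    also have "\<dots> \<le> G y" unfolding y_def using v by (intro lc) auto
    also have "\<dots> \<le> \<delta> * exp (- 1)" using R \<open>R \<le> norm y\<close> by blast
    also have "\<dots> = \<delta> powr (1 - v) * (\<delta> powr v * exp (- 1))"
      using \<delta> by (simp flip: powr_add mult.assoc)
    finally have "G x powr v \<le> \<delta> powr v * exp (- 1)" using \<delta> by simp
    then have "(G x powr v) powr (1 / v) \<le> (\<delta> powr v * exp (- 1)) powr (1 / v)"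
      using v by (intro powr_mono2) auto
    then have "G x \<le> \<delta> * exp (- 1 / v)"
      using v \<delta> nonneg[of x] by (simp add: powr_powr powr_mult exp_powr_real)
    also have "- 1 / v = - norm (x - a) / \<rho>" by (simp add: v_def)
    also have "- norm (x - a) / \<rho> \<le> (R0 - norm x) / \<rho>"
      using \<rho> Ga norm_triangle_ineq2[of x a] by (intro divide_right_mono) linarith+
    finally show ?thesis using \<delta> by simp
  qed

  \<comment> \<open>Half of the decay rate, so that the product still decays exponentially.\<close>
  define c where "c = 1 / (2 * \<rho>)"
  have c: "0 < c" using \<rho> by (simp add: c_def)
  have "(\<integral>\<^sup>+ x. ennreal (G x * exp (c * norm x)) \<partial>lborel)
    \<le> (\<integral>\<^sup>+ x. ennreal (exp (c * (\<rho> + R0))) * ennreal (G x)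
          + ennreal (\<delta> * exp (R0 / \<rho>)) * ennreal (exp (- (c * norm x))) \<partial>lborel)"
  proof (rule nn_integral_mono)
    fix x
    have "G x * exp (c * norm x) \<le> exp (c * (\<rho> + R0)) * G x + \<delta> * exp (R0 / \<rho>) * exp (- (c * norm x))"
    proof (cases "\<rho> < norm (x - a)")
      case True
      have "G x * exp (c * norm x) \<le> \<delta> * exp ((R0 - norm x) / \<rho>) * exp (c * norm x)"
        using decay[OF True] by (intro mult_right_mono) auto
      also have "\<dots> = \<delta> * exp (R0 / \<rho>) * exp (- (c * norm x))"
        using \<rho> by (simp add: c_def field_simps flip: exp_add)
      finally show ?thesis using nonneg[of x] by (simp add: add_increasing)
    next
      case False
      then have "norm x \<le> \<rho> + R0" using Ga norm_triangle_ineq2[of x a] by linarith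
      then have "G x * exp (c * norm x) \<le> G x * exp (c * (\<rho> + R0))"
        using c nonneg[of x] by (intro mult_left_mono) auto
      then show ?thesis using \<delta> by (simp add: add_increasing2 mult.commute)
    qed
    then show "ennreal (G x * exp (c * norm x)) \<le> ennreal (exp (c * (\<rho> + R0))) * ennreal (G x)
          + ennreal (\<delta> * exp (R0 / \<rho>)) * ennreal (exp (- (c * norm x)))"
      using nonneg[of x] \<delta> by (simp flip: ennreal_mult ennreal_plus)
  qed
  also have "\<dots> = ennreal (exp (c * (\<rho> + R0))) * (\<integral>\<^sup>+ x. ennreal (G x) \<partial>lborel)
          + ennreal (\<delta> * exp (R0 / \<rho>)) * (\<integral>\<^sup>+ x. ennreal (exp (- (c * norm x))) \<partial>(lborel :: 'a measure))"
    by (simp add: nn_integral_add nn_integral_cmult)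
  also have "\<dots> < \<infinity>"
    using fin nn_integral_exp_minus_norm[OF c, where 'a = 'a] by (simp add: ennreal_mult_less_top)
  finally show ?thesis using c by blast
qed

section \<open>Minima of the Laplace transform and vanishing first moments\<close>

text \<open>
  Second-order control of \<open>exp\<close> that stays usable for large \<open>u\<close> under an exponential moment.
\<close>

lemma exp_le_quadratic: "exp u \<le> 1 + u + u\<^sup>2 * exp \<bar>u\<bar>" for u :: real
proof -
  have *: "exp u - 1 \<le> u * exp u" for u :: real
    using mult_right_mono[OF exp_ge_add_one_self[of "- u"], of "exp u"]
    by (simp add: algebra_simps flip: exp_add)
  have "exp u - 1 - u \<le> u * exp u - u" using *[of u] by simp
  also have "\<dots> = u * (exp u - 1)" by (simp add: algebra_simps)
  also have "\<dots> \<le> u\<^sup>2 * exp \<bar>u\<bar>"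
  proof (cases "0 \<le> u")
    case True
    then have "u * (exp u - 1) \<le> u * (u * exp u)" using * by (intro mult_left_mono)
    then show ?thesis using True by (simp add: power2_eq_square mult.assoc)
  next
    case False
    have "u * (exp u - 1) = (- u) * (1 - exp u)" by (simp add: algebra_simps)
    also have "\<dots> \<le> (- u) * (- u)"
      using False exp_ge_add_one_self[of u] by (intro mult_left_mono; linarith)
    also have "\<dots> = u\<^sup>2 * 1" by (simp add: power2_eq_square)
    also have "\<dots> \<le> u\<^sup>2 * exp \<bar>u\<bar>" by (intro mult_left_mono) auto
    finally show ?thesis .
  qed
  finally show ?thesis by simp
qed

lemma powers_le_exp:
  fixes c r :: real
  assumes "0 < c" "0 \<le> r"
  shows "1 + r \<le> (1 + 1 / c) * exp (c * r)" and "r\<^sup>2 \<le> 2 / c\<^sup>2 * exp (c * r)"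
proof -
  have "c * r \<le> exp (c * r)" using exp_ge_add_one_self[of "c * r"] by linarith
  then have "r \<le> 1 / c * exp (c * r)" using assms by (simp add: field_simps)
  moreover have "1 \<le> exp (c * r)" using assms by simp
  ultimately have "1 + r \<le> exp (c * r) + 1 / c * exp (c * r)" by linarith
  then show "1 + r \<le> (1 + 1 / c) * exp (c * r)" by (simp add: distrib_right)
  have "0 \<le> c * r" using assms by simp
  from exp_lower_Taylor_quadratic[OF this] this have "(c * r)\<^sup>2 / 2 \<le> exp (c * r)" by linarith
  then show "r\<^sup>2 \<le> 2 / c\<^sup>2 * exp (c * r)" using assms by (simp add: field_simps power_mult_distrib)
qed

lemma integrable_if_exp_moment:
  fixes G :: "'a::euclidean_space \<Rightarrow> real" and F :: "'a \<Rightarrow> real"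
  assumes [measurable]: "G \<in> borel_measurable borel" "F \<in> borel_measurable borel"
    and nonneg: "\<And>x. 0 \<le> G x" 
    and fin: "(\<integral>\<^sup>+ x. ennreal (G x * exp (c * norm x)) \<partial>lborel) < \<infinity>"
    and F: "\<And>x. \<bar>F x\<bar> \<le> K * exp (c * norm x)"
  shows "integrable lborel (\<lambda>x. G x * F x)"
proof (rule Bochner_Integration.integrable_bound)
  have "integrable lborel (\<lambda>x. G x * exp (c * norm x))"
    using fin nonneg by (intro integrableI_nonneg) auto
  then show "integrable lborel (\<lambda>x. K * (G x * exp (c * norm x)))" by simp
  show "AE x in lborel. norm (G x * F x) \<le> norm (K * (G x * exp (c * norm x)))"
  proof (rule AE_I2)
    fix x
    have "norm (G x * F x) \<le> G x * (K * exp (c * norm x))"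
      using mult_left_mono[OF F nonneg] nonneg[of x] by (simp add: abs_mult)
    also have "\<dots> \<le> norm (K * (G x * exp (c * norm x)))" by (simp add: mult_ac)
    finally show "norm (G x * F x) \<le> norm (K * (G x * exp (c * norm x)))" .
  qed
qed simp

lemma integrable_scaleR_if_first_moment:
  fixes G :: "'a::euclidean_space \<Rightarrow> real"
  assumes [measurable]: "G \<in> borel_measurable borel"
    and nonneg: "\<And>x. 0 \<le> G x" 
    and int: "integrable lborel (\<lambda>x. (1 + norm x) * G x)"
  shows "integrable lborel G" "integrable lborel (\<lambda>x. G x *\<^sub>R x)"
proof -
  have *: "norm (G x) \<le> norm ((1 + norm x) * G x)" "norm (G x *\<^sub>R x) \<le> norm ((1 + norm x) * G x)" for x
    using nonneg[of x] by (simp_all add: abs_mult distrib_right)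
  show "integrable lborel G"
    by (rule Bochner_Integration.integrable_bound[OF int _ AE_I2[OF *(1)]]) measurable
  show "integrable lborel (\<lambda>x. G x *\<^sub>R x)"
    by (rule Bochner_Integration.integrable_bound[OF int _ AE_I2[OF *(2)]]) measurable
qed

text \<open>
  The first-order condition at a minimum. If the first moment \<open>b\<close> did not vanish, a short step in
  the direction \<open>- b\<close> would lower the value: the linear term of the exponential wins against the
  quadratic error, whose integral is finite thanks to the exponential moment.
\<close>

lemma centered_if_laplace_min:
  fixes G :: "'a::euclidean_space \<Rightarrow> real"
  assumes [measurable]: "G \<in> borel_measurable borel"
    and nonneg: "\<And>x. 0 \<le> G x"
    and c: "0 < c" and fin: "(\<integral>\<^sup>+ x. ennreal (G x * exp (c * norm x)) \<partial>lborel) < \<infinity>"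
    and min: "is_minimizer (laplace (\<lambda>x. ennreal (G x))) 0"
  shows "(\<integral>x. G x *\<^sub>R x \<partial>lborel) = 0"
proof (rule ccontr)
  define b where "b = (\<integral>x. G x *\<^sub>R x \<partial>lborel)"
  assume "(\<integral>x. G x *\<^sub>R x \<partial>lborel) \<noteq> 0"
  then have b: "b \<noteq> 0" unfolding b_def .
  note int = integrable_if_exp_moment[OF assms(1) _ nonneg fin]
  have "integrable lborel (\<lambda>x. G x * (1 + norm x))"
  proof (rule int)
    show "\<bar>1 + norm x\<bar> \<le> (1 + 1 / c) * exp (c * norm x)" for x :: 'a
      using powers_le_exp(1)[OF c norm_ge_zero[of x]] by simp
  qed simp
  then have int1: "integrable lborel (\<lambda>x. (1 + norm x) * G x)" by (simp add: mult.commute)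
  note intG = integrable_scaleR_if_first_moment[OF assms(1) nonneg int1]
  have intE: "integrable lborel (\<lambda>x. G x * exp (c * norm x))"
    by (rule int[of _ 1]) auto
  define K where "K = (\<integral>x. G x * exp (c * norm x) \<partial>lborel)"
  have K: "0 \<le> K" unfolding K_def using nonneg by (intro Bochner_Integration.integral_nonneg) auto
  \<comment> \<open>The first bound keeps \<open>x \<bullet> w\<close> below \<open>c / 2 * norm x\<close>, so that the quadratic error has a
    finite integral; the second makes this error smaller than the first-order gain \<open>t * (norm b)\<^sup>2\<close>.\<close>
  define t where "t = min (c / (2 * norm b)) (c\<^sup>2 / (8 * (K + 1)))"
  have t: "0 < t" "t * norm b \<le> c / 2" "t * (8 / c\<^sup>2 * K) < 1"
  proof -
    show "0 < t" using b c K by (simp add: t_def)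
    have "t \<le> c / (2 * norm b)" by (simp add: t_def)
    then show "t * norm b \<le> c / 2" using b by (simp add: field_simps)
    have "t * (8 / c\<^sup>2 * K) \<le> c\<^sup>2 / (8 * (K + 1)) * (8 / c\<^sup>2 * K)"
      using K by (intro mult_right_mono) (auto simp: t_def)
    also have "\<dots> = K / (K + 1)" using c K by (simp add: field_simps)
    also have "\<dots> < 1" using K by simp
    finally show "t * (8 / c\<^sup>2 * K) < 1" .
  qed
  define w where "w = - (t *\<^sub>R b)"
  have w: "\<bar>x \<bullet> w\<bar> \<le> c / 2 * norm x" for x
  proof -
    have "\<bar>x \<bullet> w\<bar> \<le> norm x * norm w" by (rule Cauchy_Schwarz_ineq2)
    also have "\<dots> = (t * norm b) * norm x" using t by (simp add: w_def)
    also have "\<dots> \<le> c / 2 * norm x" using t by (intro mult_right_mono) auto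
    finally show ?thesis .
  qed
  have intw: "integrable lborel (\<lambda>x. G x * exp (x \<bullet> w))"
  proof (rule int[of _ 1])
    fix x
    have "x \<bullet> w \<le> c * norm x" using w[of x] c mult_right_mono[of "c/2" c "norm x"] by simp
    then show "\<bar>exp (x \<bullet> w)\<bar> \<le> 1 * exp (c * norm x)" by simp
  qed auto
  have "(\<integral>\<^sup>+ x. ennreal (G x) \<partial>lborel) \<le> (\<integral>\<^sup>+ x. ennreal (G x * exp (x \<bullet> w)) \<partial>lborel)"
    using min nonneg unfolding is_minimizer_def laplace_def by (simp add: ennreal_mult)
  then have "(\<integral>x. G x \<partial>lborel) \<le> (\<integral>x. G x * exp (x \<bullet> w) \<partial>lborel)"
    using nonneg intw intG(1) by (simp add: nn_integral_eq_integral Bochner_Integration.integral_nonneg)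
  also have "\<dots> \<le> (\<integral>x. G x + (G x *\<^sub>R x) \<bullet> w + (t * norm b)\<^sup>2 * (8 / c\<^sup>2) * (G x * exp (c * norm x)) \<partial>lborel)"
  proof (rule integral_mono)
    show "integrable lborel (\<lambda>x. G x + (G x *\<^sub>R x) \<bullet> w + (t * norm b)\<^sup>2 * (8 / c\<^sup>2) * (G x * exp (c * norm x)))"
      using intG intE by (intro Bochner_Integration.integrable_add integrable_inner_left integrable_mult_right) auto
    fix x :: 'a
    have "exp (x \<bullet> w) \<le> 1 + x \<bullet> w + (x \<bullet> w)\<^sup>2 * exp \<bar>x \<bullet> w\<bar>" by (rule exp_le_quadratic)
    also have "(x \<bullet> w)\<^sup>2 * exp \<bar>x \<bullet> w\<bar> \<le> (t * norm b)\<^sup>2 * (norm x)\<^sup>2 * exp (c / 2 * norm x)"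
    proof (intro mult_mono)
      have "\<bar>x \<bullet> w\<bar> \<le> norm x * norm w" by (rule Cauchy_Schwarz_ineq2)
      also have "\<dots> = t * norm b * norm x" using t by (simp add: w_def)
      finally have "\<bar>x \<bullet> w\<bar>\<^sup>2 \<le> (t * norm b * norm x)\<^sup>2" by (intro power_mono) auto
      then show "(x \<bullet> w)\<^sup>2 \<le> (t * norm b)\<^sup>2 * (norm x)\<^sup>2" by (simp add: power_mult_distrib)
    qed (use w in auto)
    also have "\<dots> \<le> (t * norm b)\<^sup>2 * (2 / (c / 2)\<^sup>2 * exp (c / 2 * norm x)) * exp (c / 2 * norm x)"
      using c by (intro mult_right_mono mult_left_mono powers_le_exp) auto
    also have "\<dots> = (t * norm b)\<^sup>2 * (8 / c\<^sup>2) * exp (c * norm x)"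
      by (simp add: power_divide flip: exp_add)
    finally have "exp (x \<bullet> w) \<le> 1 + x \<bullet> w + (t * norm b)\<^sup>2 * (8 / c\<^sup>2) * exp (c * norm x)" by simp
    from mult_left_mono[OF this nonneg[of x]]
    show "G x * exp (x \<bullet> w) \<le> G x + (G x *\<^sub>R x) \<bullet> w + (t * norm b)\<^sup>2 * (8 / c\<^sup>2) * (G x * exp (c * norm x))"
      by (simp add: algebra_simps)
  qed (rule intw)
  also have "\<dots> = (\<integral>x. G x \<partial>lborel) + b \<bullet> w + (t * norm b)\<^sup>2 * (8 / c\<^sup>2) * K"
    using intG intE unfolding b_def K_def
    by (simp add: integrable_inner_left integral_inner_left del: inner_scaleR_left)
  finally have "t * (norm b)\<^sup>2 \<le> (t * norm b)\<^sup>2 * (8 / c\<^sup>2) * K"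
    by (simp add: w_def power2_norm_eq_inner)
  also have "\<dots> = (t * (norm b)\<^sup>2) * (t * (8 / c\<^sup>2 * K))"
    by (simp add: power2_eq_square)
  also have "\<dots> < (t * (norm b)\<^sup>2) * 1"
    using t b by (intro mult_strict_left_mono) auto
  finally show False by simp
qed

text \<open>
  Integrate the tangent-line inequality \<open>1 + t \<le> exp t\<close> at \<open>t = x \<bullet> w\<close>. It is strict off a
  hyperplane, hence strict after integration.
\<close>

lemma laplace_strict_min_if_centered:
  fixes G :: "'a::euclidean_space \<Rightarrow> real"
  assumes [measurable]: "G \<in> borel_measurable borel"
    and nonneg: "\<And>x. 0 \<le> G x"
    and int: "integrable lborel (\<lambda>x. (1 + norm x) * G x)"
    and pos: "(\<integral>\<^sup>+ x. ennreal (G x) \<partial>lborel) \<noteq> 0"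
    and centered: "(\<integral>x. G x *\<^sub>R x \<partial>lborel) = 0"
    and w: "w \<noteq> 0"
  shows "laplace (\<lambda>x. ennreal (G x)) 0 < laplace (\<lambda>x. ennreal (G x)) w"
proof -
  note intG = integrable_scaleR_if_first_moment[OF assms(1) nonneg int]
  have L: "laplace (\<lambda>x. ennreal (G x)) v = (\<integral>\<^sup>+ x. ennreal (G x * exp (x \<bullet> v)) \<partial>lborel)" for v
    unfolding laplace_def using nonneg by (simp add: ennreal_mult)
  have L0: "laplace (\<lambda>x. ennreal (G x)) 0 = ennreal (\<integral>x. G x \<partial>lborel)"
    unfolding L using intG nonneg by (simp add: nn_integral_eq_integral)
  show ?thesis
  proof (cases "laplace (\<lambda>x. ennreal (G x)) w = \<infinity>")
    case True
    then show ?thesis by (simp add: L0)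
  next
    case False
    then have intw: "integrable lborel (\<lambda>x. G x * exp (x \<bullet> w))"
      unfolding L using nonneg by (intro integrableI_nonneg) (auto simp: less_top)
    \<comment> \<open>The gap in the tangent-line inequality for \<open>exp\<close> at 0. Its integral is the difference of
      the two values of the Laplace transform because the linear term integrates to 0.\<close>
    define D where "D x = G x * exp (x \<bullet> w) - G x - (G x *\<^sub>R x) \<bullet> w" for x
    have D: "D x = G x * (exp (x \<bullet> w) - (1 + x \<bullet> w))" for x
      by (simp add: D_def algebra_simps)
    have D0: "0 \<le> D x" for x
      unfolding D using nonneg exp_ge_add_one_self[of "x \<bullet> w"] by (intro mult_nonneg_nonneg) auto
    have intD: "integrable lborel D"
      unfolding D_def using intG intw by (intro Bochner_Integration.integrable_diff integrable_inner_left) auto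
    have "(\<integral>x. D x \<partial>lborel) = (\<integral>x. G x * exp (x \<bullet> w) \<partial>lborel) - (\<integral>x. G x \<partial>lborel)"
      unfolding D_def using intG intw centered
      by (subst Bochner_Integration.integral_diff) (auto simp del: inner_scaleR_left)
    moreover have "(\<integral>x. D x \<partial>lborel) \<noteq> 0"
    proof
      assume "(\<integral>x. D x \<partial>lborel) = 0"
      then have "AE x in lborel. D x = 0"
        using intD D0 by (simp add: integral_nonneg_eq_0_iff_AE)
      then have "AE x in lborel. ennreal (G x) = 0"
        using AE_not_in_hyperplane[OF w, of 0]
      proof eventually_elim
        case (elim x)
        have "exp (x \<bullet> w) \<noteq> 1 + x \<bullet> w"
          using ln_eq_minus_one[of "exp (x \<bullet> w)"] elim(2) by auto
        then show ?case using elim(1) by (simp add: D)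
      qed
      then show False using pos by (simp add: nn_integral_0_iff_AE)
    qed
    moreover have "0 \<le> (\<integral>x. D x \<partial>lborel)" using D0 by (intro Bochner_Integration.integral_nonneg) auto
    ultimately have "(\<integral>x. G x \<partial>lborel) < (\<integral>x. G x * exp (x \<bullet> w) \<partial>lborel)" by simp
    moreover have "laplace (\<lambda>x. ennreal (G x)) w = ennreal (\<integral>x. G x * exp (x \<bullet> w) \<partial>lborel)"
      unfolding L using intw nonneg by (intro nn_integral_eq_integral) auto
    moreover have "0 \<le> (\<integral>x. G x \<partial>lborel)" using nonneg by (intro Bochner_Integration.integral_nonneg) auto
    ultimately show ?thesis unfolding L0 by (simp add: ennreal_less_iff)
  qed
qed

section \<open>The Laplace transform of a log-concave function\<close>

definition tilt :: "('a::euclidean_space \<Rightarrow> real) \<Rightarrow> 'a \<Rightarrow> 'a \<Rightarrow> real" where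
  "tilt G w x = G x * exp (x \<bullet> w)"

lemma laplace_tilt:
  assumes "\<And>x. 0 \<le> G x"
  shows "laplace (\<lambda>x. ennreal (tilt G w x)) v = laplace (\<lambda>x. ennreal (G x)) (w + v)"
  unfolding laplace_def tilt_def using assms
  by (intro nn_integral_cong) (simp add: inner_add_right exp_add mult.assoc flip: ennreal_mult)

lemma has_barycenter_integrable_iff:
  fixes G :: "'a::euclidean_space \<Rightarrow> real"
  assumes [measurable]: "G \<in> borel_measurable borel" and nonneg: "\<And>x. 0 \<le> G x"
  shows "has_barycenter (\<lambda>x. ennreal (G x)) \<longleftrightarrow>
    integrable lborel (\<lambda>x. (1 + norm x) * G x) \<and> (\<integral>\<^sup>+ x. ennreal (G x) \<partial>lborel) \<noteq> 0"
proof -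
  have "integrable lborel (\<lambda>x. (1 + norm x) * G x)
      \<longleftrightarrow> (\<integral>\<^sup>+ x. ennreal (1 + norm x) * ennreal (G x) \<partial>lborel) < \<infinity>"
    using nonneg by (simp add: integrable_iff_bounded abs_mult ennreal_mult)
  moreover have "1 + norm x \<noteq> 0" for x :: 'a using norm_ge_zero[of x] by linarith
  then have "(\<integral>\<^sup>+ x. ennreal (1 + norm x) * ennreal (G x) \<partial>lborel) = 0
      \<longleftrightarrow> (\<integral>\<^sup>+ x. ennreal (G x) \<partial>lborel) = 0"
    by (simp add: nn_integral_0_iff_AE add_nonneg_eq_0_iff flip: ennreal_mult'')
  ultimately show ?thesis
    unfolding has_barycenter_def zero_less_iff_neq_zero by auto
qed

text \<open>
  Once the infimum is not 0, no half-space is empty and a minimum exists. Shifting the argument of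
  the Laplace transform by \<open>w\<close> replaces \<open>G\<close> by \<open>tilt G w\<close>, which is again log-concave, so any
  minimizer may be moved to the origin; log-concavity supplies the exponential moment there.
  Uniqueness comes for free from the strict inequality at a centered function.
\<close>

theorem log_concave_laplace_minimum:
  fixes G :: "'a::euclidean_space \<Rightarrow> real"
  assumes meas[measurable]: "G \<in> borel_measurable borel"
    and nonneg: "\<And>x. 0 \<le> G x"
    and lc: "\<And>x y u v. 0 < u \<Longrightarrow> 0 < v \<Longrightarrow> u + v = 1 \<Longrightarrow>
               G x powr u * G y powr v \<le> G (u *\<^sub>R x + v *\<^sub>R y)"
    and fin: "laplace (\<lambda>x. ennreal (G x)) w0 < \<infinity>"
    and Inf_pos: "(INF w. laplace (\<lambda>x. ennreal (G x)) w) \<noteq> 0"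
  shows "\<exists>!s. is_minimizer (laplace (\<lambda>x. ennreal (G x))) s"
    and "\<And>w. is_minimizer (laplace (\<lambda>x. ennreal (G x))) w \<longleftrightarrow>
           has_barycenter (\<lambda>x. ennreal (tilt G w x)) \<and> barycenter (\<lambda>x. ennreal (tilt G w x)) = 0"
proof -
  define L where "L = laplace (\<lambda>x. ennreal (G x))"
  have [measurable]: "tilt G w \<in> borel_measurable borel" for w
    unfolding tilt_def by measurable
  have tilt_nonneg: "0 \<le> tilt G w x" for w x
    using nonneg by (simp add: tilt_def)
  have L_tilt: "laplace (\<lambda>x. ennreal (tilt G w x)) v = L (w + v)" for w v
    unfolding L_def using laplace_tilt[OF nonneg] .
  have tilt_mass: "(\<integral>\<^sup>+ x. ennreal (tilt G w x) \<partial>lborel) = L w" for w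
    using L_tilt[of w 0] by (simp add: laplace_def)
  have L_pos: "L w \<noteq> 0" for w
  proof
    assume "L w = 0"
    then have "(INF w. L w) \<le> 0" by (metis INF_lower UNIV_I)
    then show False using Inf_pos by (simp add: L_def)
  qed
  have barycenter_iff: "barycenter (\<lambda>x. ennreal (tilt G w x)) = 0 \<longleftrightarrow> (\<integral>x. tilt G w x *\<^sub>R x \<partial>lborel) = 0"
    if "has_barycenter (\<lambda>x. ennreal (tilt G w x))" for w
  proof -
    have int: "integrable lborel (tilt G w)"
      using that tilt_nonneg
      by (simp add: has_barycenter_integrable_iff integrable_scaleR_if_first_moment(1))
    then have "ennreal (\<integral>x. tilt G w x \<partial>lborel) = L w"
      using tilt_nonneg nn_integral_eq_integral[OF int] tilt_mass[of w] by simp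
    then have "(\<integral>x. tilt G w x \<partial>lborel) \<noteq> 0" using L_pos[of w] by auto
    then show ?thesis using tilt_nonneg by (simp add: barycenter_def)
  qed
  have centered: "has_barycenter (\<lambda>x. ennreal (tilt G w x)) \<and> barycenter (\<lambda>x. ennreal (tilt G w x)) = 0"
    if min: "is_minimizer L w" for w
  proof -
    have "L w < \<infinity>" using min fin unfolding is_minimizer_def L_def by (meson le_less_trans)
    have "tilt G w x powr u * tilt G w y powr v \<le> tilt G w (u *\<^sub>R x + v *\<^sub>R y)"
      if uv: "0 < u" "0 < v" "u + v = 1" for x y u v
    proof -
      have "tilt G w x powr u * tilt G w y powr v
          = (G x powr u * G y powr v) * exp ((u *\<^sub>R x + v *\<^sub>R y) \<bullet> w)"
        using nonneg by (simp add: tilt_def powr_mult inner_add_left exp_add exp_powr_real mult_ac)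
      also have "\<dots> \<le> tilt G w (u *\<^sub>R x + v *\<^sub>R y)"
        unfolding tilt_def using lc[OF uv] by (intro mult_right_mono) auto
      finally show ?thesis .
    qed
    then obtain c where c: "0 < c" "(\<integral>\<^sup>+ x. ennreal (tilt G w x * exp (c * norm x)) \<partial>lborel) < \<infinity>"
      using log_concave_exp_moment[of "tilt G w"] tilt_nonneg tilt_mass \<open>L w < \<infinity>\<close> L_pos by auto
    have "integrable lborel (\<lambda>x. tilt G w x * (1 + norm x))"
    proof (rule integrable_if_exp_moment[OF _ _ tilt_nonneg c(2)])
      show "\<bar>1 + norm x\<bar> \<le> (1 + 1 / c) * exp (c * norm x)" for x :: 'a
        using powers_le_exp(1)[OF c(1) norm_ge_zero[of x]] by simp
    qed measurable
    then have "has_barycenter (\<lambda>x. ennreal (tilt G w x))"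
      using tilt_nonneg tilt_mass L_pos by (simp add: has_barycenter_integrable_iff mult.commute)
    moreover have "is_minimizer (laplace (\<lambda>x. ennreal (tilt G w x))) 0"
      using min unfolding is_minimizer_def L_tilt by simp
    then have "(\<integral>x. tilt G w x *\<^sub>R x \<partial>lborel) = 0"
      by (intro centered_if_laplace_min[OF _ tilt_nonneg c]) auto
    ultimately show ?thesis using barycenter_iff by blast
  qed
  have strict: "L w < L v"
    if "has_barycenter (\<lambda>x. ennreal (tilt G w x))" "barycenter (\<lambda>x. ennreal (tilt G w x)) = 0" "v \<noteq> w" for v w
    using laplace_strict_min_if_centered[of "tilt G w" "v - w"] that tilt_nonneg barycenter_iff
    by (simp add: L_tilt has_barycenter_integrable_iff)
  show iff: "is_minimizer (laplace (\<lambda>x. ennreal (G x))) w \<longleftrightarrow>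
           has_barycenter (\<lambda>x. ennreal (tilt G w x)) \<and> barycenter (\<lambda>x. ennreal (tilt G w x)) = 0" for w
    using centered[of w] strict[of w] unfolding L_def[symmetric]
    by (metis is_minimizer_def order.refl less_imp_le)
  have "(\<integral>\<^sup>+ x. ennreal (G x) * indicator {x. 0 < x \<bullet> \<theta>} x \<partial>lborel) \<noteq> 0" if "\<theta> \<noteq> 0" for \<theta>
    using laplace_INF_eq_0_if_halfspace_null[OF _ that _ fin] Inf_pos by auto
  from laplace_attains_minimum[OF _ this fin] obtain s where s: "is_minimizer L s"
    unfolding L_def by auto
  moreover have "s' = s" if "is_minimizer L s'" for s'
    using strict[of s s'] centered[OF s] that unfolding is_minimizer_def by (meson not_le)
  ultimately show "\<exists>!s. is_minimizer (laplace (\<lambda>x. ennreal (G x))) s"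
    unfolding L_def[symmetric] by blast
qed

section \<open>The p-Laplace transform\<close>

lemma ennreal_neg_powr_measurable[measurable]:
  "(\<lambda>u. ennreal_neg_powr u q) \<in> borel_measurable borel"
  unfolding ennreal_neg_powr_def by measurable

lemma ennreal_neg_powr_ennreal:
  "0 < r \<Longrightarrow> ennreal_neg_powr (ennreal r) q = ennreal (r powr q)"
  by (simp add: ennreal_neg_powr_def)

lemma ennreal_neg_powr_mult:
  assumes "0 < a"
  shows "ennreal_neg_powr (ennreal a * u) q = ennreal_neg_powr u q * ennreal (a powr q)"
proof (cases u)
  case (real r)
  show ?thesis
  proof (cases "r = 0")
    case False
    then have "0 < r" using real by simp
    then show ?thesis
      using assms real by (simp add: ennreal_neg_powr_ennreal powr_mult mult.commute flip: ennreal_mult)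
  qed (use assms real in \<open>simp add: ennreal_neg_powr_def ennreal_top_mult\<close>)
qed (use assms in \<open>simp add: ennreal_neg_powr_def ennreal_mult_top\<close>)

lemma ennreal_neg_powr_le:
  assumes "0 < c" "ennreal c \<le> u" "q < 0"
  shows "ennreal_neg_powr u q \<le> ennreal (c powr q)"
proof (cases u)
  case (real r)
  then have "c \<le> r" using assms by simp
  then show ?thesis
    using assms real by (simp add: ennreal_neg_powr_ennreal ennreal_leI powr_mono2')
qed (simp add: ennreal_neg_powr_def)

context
  fixes f :: "'a::euclidean_space \<Rightarrow> real" and p q :: real
  assumes p: "0 < p" "p < 1"
    and q: "q = p / (p - 1)"
    and f_borel[measurable]: "f \<in> borel_measurable borel"
    and f_nonzero: "emeasure lborel {x. f x > 0} \<noteq> 0"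
begin

definition "root_laplace = laplace (\<lambda>y. ennreal (f y powr (1 / p)))"

lemma q_neg: "q < 0"
  using p unfolding q by (simp add: divide_pos_neg)

lemma root_laplace_pos: "root_laplace x \<noteq> 0"
proof
  assume "root_laplace x = 0"
  then have "AE y in lborel. ennreal (f y powr (1 / p)) * ennreal (exp (y \<bullet> x)) = 0"
    unfolding root_laplace_def laplace_def by (subst (asm) nn_integral_0_iff_AE) auto
  then have "AE y in lborel. \<not> 0 < f y"
    by eventually_elim (auto simp: ennreal_eq_0_iff)
  then show False
    using f_nonzero by (subst (asm) AE_iff_measurable[OF _ refl]) auto
qed

lemma laplace_p_eq: "laplace_p p f x = ennreal_neg_powr (root_laplace x) q"
  by (simp add: laplace_p_def root_laplace_def q)

lemma laplace_p_measurable[measurable]: "laplace_p p f \<in> borel_measurable borel"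
  unfolding laplace_p_eq[abs_def] root_laplace_def by measurable

lemma laplace_p_finite: "laplace_p p f x < \<infinity>"
  using root_laplace_pos[of x] by (simp add: laplace_p_eq ennreal_neg_powr_def)

lemma laplace_p_translate:
  "laplace_p p (translate z f) x = laplace_p p f x * ennreal (exp (q * (x \<bullet> z)))"
proof -
  have "laplace_p p (translate z f) x
      = ennreal_neg_powr (laplace (translate z (\<lambda>y. ennreal (f y powr (1 / p)))) x) q"
    by (simp add: laplace_p_def translate_def q)
  also have "\<dots> = ennreal_neg_powr (ennreal (exp (z \<bullet> x)) * root_laplace x) q"
    by (subst laplace_translate) (simp_all add: root_laplace_def)
  also have "\<dots> = laplace_p p f x * ennreal (exp (q * (x \<bullet> z)))"
    by (simp add: ennreal_neg_powr_mult laplace_p_eq exp_powr_real inner_commute[of x] mult.commute[of q])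
  finally show ?thesis .
qed

lemma psi_integral: "psi p f z = (\<integral>\<^sup>+ x. laplace_p p f x * ennreal (exp (q * (x \<bullet> z))) \<partial>lborel)"
  by (simp add: psi_def laplace_p_translate)

lemma psi_laplace: "psi p f z = laplace (laplace_p p f) (q *\<^sub>R z)"
  by (simp add: psi_integral laplace_def)

lemma psi_convex: "convex_ennreal (psi p f)"
  unfolding convex_ennreal_def
proof (intro allI impI)
  fix x y :: 'a and u v :: real
  assume uv: "0 \<le> u" "0 \<le> v" "u + v = 1"
  have "psi p f (u *\<^sub>R x + v *\<^sub>R y) = laplace (laplace_p p f) (u *\<^sub>R (q *\<^sub>R x) + v *\<^sub>R (q *\<^sub>R y))"
    by (simp add: psi_laplace scaleR_add_right mult.commute)
  also have "\<dots> \<le> ennreal u * psi p f x + ennreal v * psi p f y"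
    using laplace_convex[OF laplace_p_measurable] uv unfolding convex_ennreal_def psi_laplace by blast
  finally show "psi p f (u *\<^sub>R x + v *\<^sub>R y) \<le> ennreal u * psi p f x + ennreal v * psi p f y" .
qed

text \<open>
  The root transform is log-convex and \<open>q\<close> is negative. Where the root transform is infinite,
  \<open>laplace_p\<close> is 0 and the inequality is trivial.
\<close>

lemma laplace_p_log_concave:
  assumes uv: "0 < u" "0 < v" "u + v = 1"
  shows "enn2real (laplace_p p f x) powr u * enn2real (laplace_p p f y) powr v
      \<le> enn2real (laplace_p p f (u *\<^sub>R x + v *\<^sub>R y))"
proof (cases "root_laplace x = \<infinity> \<or> root_laplace y = \<infinity>")
  case True
  then show ?thesis by (auto simp: laplace_p_eq ennreal_neg_powr_def)
next
  case False
  then obtain A B where A: "root_laplace x = ennreal A" "0 < A" and B: "root_laplace y = ennreal B" "0 < B"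
    using root_laplace_pos[of x] root_laplace_pos[of y]
    by (cases "root_laplace x"; cases "root_laplace y") (auto simp: le_less)
  let ?z = "u *\<^sub>R x + v *\<^sub>R y"
  have "root_laplace ?z \<le> ennreal (A powr u * B powr v)"
    using A B uv unfolding root_laplace_def by (intro laplace_log_convex) auto
  moreover from this obtain C where C: "root_laplace ?z = ennreal C" "0 < C"
    using root_laplace_pos[of ?z] by (cases "root_laplace ?z") (auto simp: le_less top_unique)
  ultimately have "C \<le> A powr u * B powr v" by simp
  then have "(A powr u * B powr v) powr q \<le> C powr q"
    using C q_neg by (intro powr_mono2') auto
  then show ?thesis
    using A B C by (simp add: laplace_p_eq ennreal_neg_powr_ennreal powr_mult powr_powr mult.commute)
qed

text \<open>
  Around the barycenter of a bounded piece of its support, every half-space contains mass of \<open>f\<close>.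
  The root transform of the recentred function therefore grows exponentially, and its negative power
  is integrable.
\<close>

lemma psi_proper: "\<exists>z. psi p f z < \<infinity>"
proof -
  define g where "g y = ennreal (f y powr (1 / p))" for y
  have [measurable]: "g \<in> borel_measurable borel" unfolding g_def by measurable
  obtain b where b: "\<And>\<theta>. \<theta> \<noteq> 0 \<Longrightarrow>
      (\<integral>\<^sup>+ x. translate (- b) g x * indicator {x. 0 < x \<bullet> \<theta>} x \<partial>lborel) \<noteq> 0"
    using exists_center_halfspaces[of f g] f_nonzero by (auto simp: g_def)
  have "translate (- b) g \<in> borel_measurable borel" unfolding translate_def by measurable
  from laplace_exp_growth[OF this b] obtain \<epsilon> where
    \<epsilon>: "0 < \<epsilon>" "\<And>x. ennreal (\<epsilon> * exp (\<epsilon> * norm x)) \<le> laplace (translate (- b) g) x"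
    by blast
  have "psi p f (- b) \<le> (\<integral>\<^sup>+ x. ennreal (\<epsilon> powr q) * ennreal (exp (- (- q * \<epsilon> * norm x))) \<partial>(lborel :: 'a measure))"
    unfolding psi_def
  proof (rule nn_integral_mono)
    fix x
    have "laplace_p p (translate (- b) f) x = ennreal_neg_powr (laplace (translate (- b) g) x) q"
      by (simp add: laplace_p_def translate_def g_def q)
    also have "\<dots> \<le> ennreal ((\<epsilon> * exp (\<epsilon> * norm x)) powr q)"
      using \<epsilon> q_neg by (intro ennreal_neg_powr_le) auto
    finally show "laplace_p p (translate (- b) f) x
        \<le> ennreal (\<epsilon> powr q) * ennreal (exp (- (- q * \<epsilon> * norm x)))"
      using \<epsilon>(1) by (simp add: powr_mult exp_powr_real mult_ac flip: ennreal_mult)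
  qed
  also have "\<dots> = ennreal (\<epsilon> powr q) * (\<integral>\<^sup>+ x. ennreal (exp (- (- q * \<epsilon> * norm x))) \<partial>(lborel :: 'a measure))"
    by (rule nn_integral_cmult) measurable
  also have "\<dots> < \<infinity>"
    using nn_integral_exp_minus_norm[of "- q * \<epsilon>", where 'a = 'a] \<epsilon>(1) q_neg
    by (simp add: ennreal_mult_less_top mult_neg_pos)
  finally show ?thesis by blast
qed

text \<open>
  As \<open>q\<close> is not 0, \<open>z \<mapsto> q z\<close> carries minimizers of \<open>psi p f\<close> to those of the Laplace
  transform of \<open>laplace_p p f\<close>, and tilting by \<open>q z\<close> is the effect of translating \<open>f\<close> by \<open>z\<close>.
\<close>

lemma psi_minimum:
  assumes "(INF z. psi p f z) \<noteq> 0"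
  shows "\<exists>!s. is_minimizer (psi p f) s"
    and "\<And>z. is_minimizer (psi p f) z \<longleftrightarrow>
           has_barycenter (laplace_p p (translate z f)) \<and> barycenter (laplace_p p (translate z f)) = 0"
proof -
  define G where "G x = enn2real (laplace_p p f x)" for x
  have [measurable]: "G \<in> borel_measurable borel" unfolding G_def by measurable
  have G0: "0 \<le> G x" for x by (simp add: G_def)
  have G: "(\<lambda>x. ennreal (G x)) = laplace_p p f"
    using laplace_p_finite by (auto simp: G_def)
  have lap: "laplace (\<lambda>x. ennreal (G x)) w = psi p f (w /\<^sub>R q)" for w
    using q_neg by (simp add: psi_laplace G)
  have tilt: "(\<lambda>x. ennreal (tilt G (q *\<^sub>R z) x)) = laplace_p p (translate z f)" for z
    by (auto simp: tilt_def laplace_p_translate ennreal_mult G0 fun_cong[OF G, simplified])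
  have min: "is_minimizer (psi p f) z \<longleftrightarrow> is_minimizer (laplace (\<lambda>x. ennreal (G x))) (q *\<^sub>R z)" for z
  proof -
    have "(\<forall>w. psi p f z \<le> psi p f (w /\<^sub>R q)) \<longleftrightarrow> (\<forall>y. psi p f z \<le> psi p f y)"
    proof
      assume *: "\<forall>w. psi p f z \<le> psi p f (w /\<^sub>R q)"
      show "\<forall>y. psi p f z \<le> psi p f y"
        using *[rule_format, of "q *\<^sub>R _"] q_neg by simp
    qed simp
    then show ?thesis using q_neg by (simp add: is_minimizer_def lap)
  qed
  obtain z0 where "psi p f z0 < \<infinity>" using psi_proper by blast
  then have fin: "laplace (\<lambda>x. ennreal (G x)) (q *\<^sub>R z0) < \<infinity>"
    using q_neg by (simp add: lap)
  have "(INF z. psi p f z) \<le> (INF w. laplace (\<lambda>x. ennreal (G x)) w)"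
    by (rule INF_greatest) (simp add: lap INF_lower)
  then have pos: "(INF w. laplace (\<lambda>x. ennreal (G x)) w) \<noteq> 0"
    using assms by (metis le_zero_eq)
  note main = log_concave_laplace_minimum[of G, OF _ G0 _ fin pos]
  have lc: "G x powr u * G y powr v \<le> G (u *\<^sub>R x + v *\<^sub>R y)" if "0 < u" "0 < v" "u + v = 1" for x y u v
    unfolding G_def using that by (rule laplace_p_log_concave)
  have "\<exists>!s. is_minimizer (laplace (\<lambda>x. ennreal (G x))) s"
    by (rule main(1)[OF _ lc]) measurable
  then obtain s where s: "is_minimizer (laplace (\<lambda>x. ennreal (G x))) s"
      "\<And>t. is_minimizer (laplace (\<lambda>x. ennreal (G x))) t \<Longrightarrow> t = s"
    by (elim ex1E) blast
  show "\<exists>!s. is_minimizer (psi p f) s"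
  proof
    show "is_minimizer (psi p f) (s /\<^sub>R q)" using s(1) q_neg by (simp add: min)
    show "t = s /\<^sub>R q" if "is_minimizer (psi p f) t" for t
      using s(2)[of "q *\<^sub>R t"] that q_neg by (auto simp: min)
  qed
  show "is_minimizer (psi p f) z \<longleftrightarrow>
     has_barycenter (laplace_p p (translate z f)) \<and> barycenter (laplace_p p (translate z f)) = 0" for z
    unfolding min using main(2)[of "q *\<^sub>R z"] lc unfolding tilt by auto
qed

end

theorem proposition1p3:
  fixes f :: "real ^ 'n \<Rightarrow> real" and p q :: real
  assumes p: "0 < p" "p < 1"
    and q: "q = p / (p - 1)"
    and f_borel: "f \<in> borel_measurable borel"
    and f_nonneg: "\<And>x. 0 \<le> f x"
    and f_nonzero: "emeasure lborel {x. f x > 0} \<noteq> 0"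
  shows "(\<forall>z. psi p f z = (\<integral>\<^sup>+ x. laplace_p p f x * ennreal (exp (q * (x \<bullet> z))) \<partial>lborel))
    \<and> (\<forall>z. psi p f z = laplace (laplace_p p f) (q *\<^sub>R z))
    \<and> convex_ennreal (psi p f)
    \<and> (\<exists>z0. psi p f z0 < \<infinity>)
    \<and> (INF z. psi p f z) < \<infinity>
    \<and> ((INF z. psi p f z) = 0
       \<or> ((\<exists>!s. is_minimizer (psi p f) s)
          \<and> psi p f (s_point p f) \<noteq> 0
          \<and> (\<forall>z. z = s_point p f \<longleftrightarrow>
                 has_barycenter (laplace_p p (translate z f))
                 \<and> barycenter (laplace_p p (translate z f)) = 0)))"
proof -
  note hyps = p q f_borel f_nonzero
  obtain z0 where z0: "psi p f z0 < \<infinity>" using psi_proper[OF hyps] by blast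
  have minimum: "(\<exists>!s. is_minimizer (psi p f) s)
          \<and> psi p f (s_point p f) \<noteq> 0
          \<and> (\<forall>z. z = s_point p f \<longleftrightarrow>
                 has_barycenter (laplace_p p (translate z f))
                 \<and> barycenter (laplace_p p (translate z f)) = 0)"
    if pos: "(INF z. psi p f z) \<noteq> 0"
  proof (intro conjI allI)
    show ex1: "\<exists>!s. is_minimizer (psi p f) s" by (rule psi_minimum(1)[OF hyps pos])
    then have s: "is_minimizer (psi p f) (s_point p f)"
      unfolding s_point_def by (rule theI')
    have "(INF z. psi p f z) \<le> psi p f (s_point p f)" by (rule INF_lower) simp
    then show "psi p f (s_point p f) \<noteq> 0" using pos by auto
    show "z = s_point p f \<longleftrightarrow> has_barycenter (laplace_p p (translate z f))
                 \<and> barycenter (laplace_p p (translate z f)) = 0" for z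
      using psi_minimum(2)[OF hyps pos, of z] ex1 s by blast
  qed
  have Inf_finite: "(INF z. psi p f z) < \<infinity>"
    using INF_lower[of z0 UNIV "psi p f"] z0 by (simp add: le_less_trans)
  show ?thesis
  proof (intro conjI)
    show "\<forall>z. psi p f z = (\<integral>\<^sup>+ x. laplace_p p f x * ennreal (exp (q * (x \<bullet> z))) \<partial>lborel)"
      by (intro allI psi_integral hyps)
    show "\<forall>z. psi p f z = laplace (laplace_p p f) (q *\<^sub>R z)"
      by (intro allI psi_laplace hyps)
    show "convex_ennreal (psi p f)" by (rule psi_convex[OF hyps])
    show "\<exists>z0. psi p f z0 < \<infinity>" using z0 by blast
  qed (use Inf_finite minimum in \<open>blast+\<close>)
qed

end
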